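(* Let $(\Omega,\{T_\omega\},\mathbb{P}_\epsilon)$ be the family of random maps on $[0,1]$ described in the context, with annealed transfer operators $L_\epsilon: C^{l}([0,1])\to C^{l}([0,1])$. Assume that (1) $L_\epsilon$ has a uniform spectral gap in $C^{l}([0,1])$, $l\ge 1$; (2) $\epsilon\mapsto L_\epsilon h_0$ is $k$ times differentiable as an element of $C^l([0,1])$ at $\epsilon=0$; (3) $\epsilon\mapsto (I-L_\epsilon)^{-1}G_i$ is $k-i$ times differentiable in $C^l([0,1])$ at $\epsilon=0$, where $h_0$ is the invariant density of the system $(\Omega,\{T_\omega\},\mathbb{P}_0)$ and $G_i:=\partial_\epsilon^i L_\epsilon h_0|_{\epsilon=0}$ with $i=0,\dots,k-1$. Then $\epsilon\mapsto h_\epsilon$ is $k$ times differentiable as an element of $C^l([0,1])$ at $\epsilon=0$. In particular, the invariant density $h_\epsilon$ of the system $(\Omega,\{T_\omega\},\mathbb{P}_\epsilon)$ can be approximated using the formula $$h_\epsilon=h_0+\sum_{n=1}^k\frac{\epsilon^n}{n!}\,\partial_\epsilon^n h_\epsilon|_{\epsilon=0}+o(\epsilon^k),$$ where $$\partial_\epsilon^n h_\epsilon|_{\epsilon=0}=\sum_{i=1}^n\binom{n}{i}H_{i,n-i}\qquad\text{and}\qquad H_{i,n-i}=\partial_\epsilon^{n-i}(I-L_\epsilon)^{-1}G_i|_{\epsilon=0}$$ (for $i=k$, $G_k$ is given by the same formula $G_k=\partial_\epsilon^k L_\epsilon h_0|_{\epsilon=0}$).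
   Context: $m$ is Lebesgue measure on $[0,1]$. $\{T_\omega\}_{\omega\in\Omega}$ is a family of maps $T_\omega:[0,1]\to[0,1]$, non-singular with respect to $m$, such that each $T_\omega$ has at most countably many branches, labeled by elements of a set $A$: for each $\omega$, $\{I_{a,\omega}: a\in A\}$ is a partition of $[0,1]$ into half-open intervals such that the restriction of $T_\omega$ to each $I_{a,\omega}$ is surjective and $C^{l+1}$. Write $V_{a,\omega}$ for the inverse of the restriction of $T_\omega$ to $I_{a,\omega}$. The transfer operator of $T_\omega$ is $L_{T_\omega}\Phi=\sum_{a\in A}|V_{a,\omega}'|\cdot \Phi\circ V_{a,\omega}$. For each value of the perturbation parameter $\epsilon$, $\mathbb{P}_\epsilon$ is a probability measure on $\Omega$; the random map $(\Omega,\{T_\omega\},\mathbb{P}_\epsilon)$ consists of independent identically distributed compositions of the maps $T_\omega$, with $\omega$ chosen according to $\mathbb{P}_\epsilon$. The unperturbed system is the case $\epsilon=0$. The annealed transfer operator is $L_\epsilon\Phi=\int_\Omega L_{T_\omega}\Phi\,d\mathbb{P}_\epsilon(\omega)$, acting as an operator $L_\epsilon:C^l([0,1])\to C^l([0,1])$. The invariant density $h_\epsilon$ of $(\Omega,\{T_\omega\},\mathbb{P}_\epsilon)$ is the density, with respect to $m$, of the absolutely continuous stationary probability measure; it satisfies $L_\epsilon h_\epsilon=h_\epsilon$. The family $L_\epsilon$ has a uniform spectral gap in $C^l([0,1])$ if there is $\delta\in(0,1)$, independent of $\epsilon$, such that for all $\epsilon$ small enough, $1$ is the unique (and simple) eigenvalue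 of $L_\epsilon$ of modulus one, and the rest of the spectrum is contained in the ball centered at $0$ of radius $\delta$, i.e. $\sigma(L_\epsilon)\setminus\{1\}\subset B(0,\delta)$. $I$ is the identity operator. Under the uniform spectral gap, $(I-L_\epsilon)^{-1}$ is well defined, and uniformly bounded in $\epsilon$, on $C^l_0([0,1])$, the subset of elements of $C^l([0,1])$ with zero average with respect to $m$.
   Formalization: "k times differentiable at 0" is read as having an order-k Taylor expansion at 0 in C^l with o(ε^k) remainder; (3) is assumed for i=1,…,k instead of i=0,…,k−1; the uniform bound on (I−L_ε)^{-1} over C^l_0 is an explicit hypothesis. *)

theory Defs
  imports "HOL-Probability.Probability"
begin

definition deriv_on :: "real set \<Rightarrow> (real \<Rightarrow> 'b::real_normed_vector) \<Rightarrow> real \<Rightarrow> 'b" where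
  "deriv_on S f x = vector_derivative f (at x within S)"

definition Ck_on :: "nat \<Rightarrow> (real \<Rightarrow> 'b::real_normed_vector) \<Rightarrow> real set \<Rightarrow> bool" where
  "Ck_on k f S \<longleftrightarrow>
     (\<forall>i<k. \<forall>x\<in>S. ((deriv_on S ^^ i) f) differentiable (at x within S)) \<and>
     continuous_on S ((deriv_on S ^^ k) f)"

text \<open>
  Elements of \<open>C^l([0,1])\<close> are represented by total functions that vanish outside \<open>[0,1]\<close>,
  so that equality of representatives is equality on \<open>[0,1]\<close>. Real and complex scalars are
  both needed (the latter for the spectrum).
\<close>

definition Cl :: "nat \<Rightarrow> (real \<Rightarrow> 'b::real_normed_vector) set" where
  "Cl l = {f. Ck_on l f {0..1} \<and> (\<forall>x. x \<notin> {0..1} \<longrightarrow> f x = 0)}"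

definition Cl_norm :: "nat \<Rightarrow> (real \<Rightarrow> 'b::real_normed_vector) \<Rightarrow> real" where
  "Cl_norm l f = (\<Sum>i\<le>l. SUP x\<in>{0..1}. norm ((deriv_on {0..1} ^^ i) f x))"

definition leb01 :: "real measure" where
  "leb01 = restrict_space lborel {0..1}"

definition Cl0 :: "nat \<Rightarrow> (real \<Rightarrow> real) set" where
  "Cl0 l = {f \<in> Cl l. (\<integral>x. f x \<partial>leb01) = 0}"

text \<open>
  The parameter ranges over a set \<open>E\<close> of reals having \<open>0\<close> as an element and as a limit
  point; this covers two-sided and one-sided neighbourhoods of \<open>0\<close>. A curve is \<open>k\<close> times
  differentiable at \<open>0\<close> if it has a Taylor expansion of order \<open>k\<close> at \<open>0\<close> with remainder
  \<open>o(\<epsilon>^k)\<close> in the norm of \<open>C^l\<close>; the \<open>n\<close>-th derivative is the coefficient of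
  \<open>\<epsilon>^n / n!\<close>. No differentiability at parameters other than \<open>0\<close> is involved. For \<open>k = 0\<close>
  this is continuity at \<open>0\<close>, for \<open>k = 1\<close> it is the usual differentiability at \<open>0\<close>.
\<close>

definition taylor_at_0 ::
    "nat \<Rightarrow> real set \<Rightarrow> nat \<Rightarrow> (real \<Rightarrow> real \<Rightarrow> real) \<Rightarrow> (nat \<Rightarrow> real \<Rightarrow> real) \<Rightarrow> bool" where
  "taylor_at_0 l E k F c \<longleftrightarrow>
     (\<forall>n\<le>k. c n \<in> Cl l) \<and> F 0 = c 0 \<and>
     (\<forall>\<^sub>F \<epsilon> in at 0 within E. F \<epsilon> \<in> Cl l) \<and>
     (\<lambda>\<epsilon>. Cl_norm l (\<lambda>x. F \<epsilon> x - (\<Sum>n\<le>k. \<epsilon> ^ n / fact n * c n x)))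
       \<in> o[at 0 within E](\<lambda>\<epsilon>. \<epsilon> ^ k)"

definition times_diff_at_0 ::
    "nat \<Rightarrow> real set \<Rightarrow> nat \<Rightarrow> (real \<Rightarrow> real \<Rightarrow> real) \<Rightarrow> bool" where
  "times_diff_at_0 l E k F \<longleftrightarrow> (\<exists>c. taylor_at_0 l E k F c)"

definition nth_deriv_at_0 ::
    "nat \<Rightarrow> real set \<Rightarrow> nat \<Rightarrow> (real \<Rightarrow> real \<Rightarrow> real) \<Rightarrow> real \<Rightarrow> real" where
  "nth_deriv_at_0 l E n F = (THE g. \<exists>c. taylor_at_0 l E n F c \<and> c n = g)"

definition Cl_spectrum ::
    "nat \<Rightarrow> ((real \<Rightarrow> complex) \<Rightarrow> real \<Rightarrow> complex) \<Rightarrow> complex set" where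
  "Cl_spectrum l L = - {z.
     bij_betw (\<lambda>f x. z * f x - L f x) (Cl l) (Cl l) \<and>
     (\<exists>C. \<forall>f\<in>Cl l. Cl_norm l f \<le> C * Cl_norm l (\<lambda>x. z * f x - L f x))}"

definition Cl_eigenvalue ::
    "nat \<Rightarrow> ((real \<Rightarrow> complex) \<Rightarrow> real \<Rightarrow> complex) \<Rightarrow> complex \<Rightarrow> bool" where
  "Cl_eigenvalue l L z \<longleftrightarrow> (\<exists>f\<in>Cl l. f \<noteq> (\<lambda>_. 0) \<and> L f = (\<lambda>x. z * f x))"

text \<open>Simplicity is algebraic: the generalized eigenspace is one-dimensional.\<close>

definition Cl_simple_eigenvalue ::
    "nat \<Rightarrow> ((real \<Rightarrow> complex) \<Rightarrow> real \<Rightarrow> complex) \<Rightarrow> complex \<Rightarrow> bool" where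
  "Cl_simple_eigenvalue l L z \<longleftrightarrow>
     (\<exists>f\<in>Cl l. f \<noteq> (\<lambda>_. 0) \<and>
        {g \<in> Cl l. \<exists>n. ((\<lambda>u x. L u x - z * u x) ^^ n) g = (\<lambda>_. 0)} = range (\<lambda>c x. c * f x))"

definition uniform_spectral_gap ::
    "nat \<Rightarrow> real set \<Rightarrow> (real \<Rightarrow> (real \<Rightarrow> complex) \<Rightarrow> real \<Rightarrow> complex) \<Rightarrow> bool" where
  "uniform_spectral_gap l E L \<longleftrightarrow>
     (\<exists>\<delta> r. 0 < \<delta> \<and> \<delta> < 1 \<and> 0 < r \<and>
        (\<forall>\<epsilon>\<in>E. \<bar>\<epsilon>\<bar> < r \<longrightarrow>
           Cl_simple_eigenvalue l (L \<epsilon>) 1 \<and>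
           (\<forall>z. Cl_eigenvalue l (L \<epsilon>) z \<and> cmod z = 1 \<longrightarrow> z = 1) \<and>
           Cl_spectrum l (L \<epsilon>) - {1} \<subseteq> ball 0 \<delta>))"

definition inv_I_minus ::
    "nat \<Rightarrow> ((real \<Rightarrow> real) \<Rightarrow> real \<Rightarrow> real) \<Rightarrow> (real \<Rightarrow> real) \<Rightarrow> real \<Rightarrow> real" where
  "inv_I_minus l L = inv_into (Cl0 l) (\<lambda>u x. u x - L u x)"

text \<open>
  The gap controls spectra only, not norms of resolvents, so the bound on \<open>(I - L)^-1\<close>
  over zero-average functions that accompanies it is a property of its own. That
  \<open>inv_into\<close> is a genuine inverse there is not part of this definition.
\<close>

definition inv_I_minus_uniformly_bounded ::
    "nat \<Rightarrow> real set \<Rightarrow> (real \<Rightarrow> (real \<Rightarrow> real) \<Rightarrow> real \<Rightarrow> real) \<Rightarrow> bool" where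
  "inv_I_minus_uniformly_bounded l E L \<longleftrightarrow>
     (\<exists>K r. 0 < r \<and>
        (\<forall>\<epsilon>\<in>E. \<bar>\<epsilon>\<bar> < r \<longrightarrow>
           (\<forall>g\<in>Cl0 l. Cl_norm l (inv_I_minus l (L \<epsilon>) g) \<le> K * Cl_norm l g)))"

definition half_open_interval :: "real set \<Rightarrow> bool" where
  "half_open_interval J \<longleftrightarrow> (\<exists>u v. u < v \<and> (J = {u..<v} \<or> J = {u<..v}))"

text \<open>
  A continuous injective function maps a half-open interval onto a half-open interval, so a
  branch covers \<open>[0,1]\<close> up to one endpoint. The inverse branch is extended
  continuously to that endpoint, where its value is the unique point of \<open>closure J - J\<close>.
\<close>

definition full_branch :: "nat \<Rightarrow> (real \<Rightarrow> real) \<Rightarrow> real set \<Rightarrow> bool" where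
  "full_branch r f J \<longleftrightarrow>
     inj_on f J \<and> {0<..<1} \<subseteq> f ` J \<and> f ` J \<subseteq> {0..1} \<and> Ck_on r f J"

definition inv_branch :: "(real \<Rightarrow> real) \<Rightarrow> real set \<Rightarrow> real \<Rightarrow> real" where
  "inv_branch f J y =
     (if y \<in> f ` J then inv_into J f y else (THE x. x \<in> closure J - J))"

definition transfer_op ::
    "'a set \<Rightarrow> ('a \<Rightarrow> real set) \<Rightarrow> (real \<Rightarrow> real) \<Rightarrow> (real \<Rightarrow> 'b::{banach, second_countable_topology})
       \<Rightarrow> real \<Rightarrow> 'b" where
  "transfer_op A J f \<Phi> x =
     (if x \<in> {0..1}
      then \<Sum>\<^sub>\<infinity>a\<in>A. \<bar>deriv_on {0..1} (inv_branch f (J a)) x\<bar> *\<^sub>R \<Phi> (inv_branch f (J a) x)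
      else 0)"

definition annealed_op ::
    "'a set \<Rightarrow> ('a \<Rightarrow> 'w \<Rightarrow> real set) \<Rightarrow> ('w \<Rightarrow> real \<Rightarrow> real) \<Rightarrow> 'w measure
       \<Rightarrow> (real \<Rightarrow> 'b::{banach, second_countable_topology}) \<Rightarrow> real \<Rightarrow> 'b" where
  "annealed_op A I T P \<Phi> x = (\<integral>\<omega>. transfer_op A (\<lambda>a. I a \<omega>) (T \<omega>) \<Phi> x \<partial>P)"

definition invariant_density ::
    "('w \<Rightarrow> real \<Rightarrow> real) \<Rightarrow> 'w measure \<Rightarrow> (real \<Rightarrow> real) \<Rightarrow> bool" where
  "invariant_density T P h \<longleftrightarrow>
     h \<in> borel_measurable leb01 \<and> (\<forall>x\<in>{0..1}. 0 \<le> h x) \<and>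
     (let \<mu> = density leb01 (\<lambda>x. ennreal (h x)) in
        prob_space \<mu> \<and>
        (\<forall>B\<in>sets leb01. emeasure \<mu> B = (\<integral>\<^sup>+\<omega>. emeasure \<mu> (T \<omega> -` B \<inter> {0..1}) \<partial>P)))"

text \<open>
  A partition into half-open intervals is understood up to a Lebesgue null set, since \<open>[0,1]\<close>
  itself is not a disjoint union of half-open intervals. The last six assumptions express
  that the inverse branches, \<open>L_T\<close> and the annealed operators are well defined and that the
  latter are bounded operators on \<open>C^l([0,1])\<close>.
\<close>

locale random_maps =
  fixes l :: nat
    and E :: "real set"
    and W :: "'w measure"
    and P :: "real \<Rightarrow> 'w measure"
    and A :: "'a set"
    and I :: "'a \<Rightarrow> 'w \<Rightarrow> real set"
    and T :: "'w \<Rightarrow> real \<Rightarrow> real"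
  assumes zero_param: "0 \<in> E" "0 islimpt E"
    and prob: "\<And>\<epsilon>. \<epsilon> \<in> E \<Longrightarrow> prob_space (P \<epsilon>)"
    and sets_P: "\<And>\<epsilon>. \<epsilon> \<in> E \<Longrightarrow> sets (P \<epsilon>) = sets W"
    and measurable_T: "(\<lambda>(\<omega>, x). T \<omega> x) \<in> W \<Otimes>\<^sub>M leb01 \<rightarrow>\<^sub>M leb01"
    and nonsingular: "\<And>\<omega> N. \<omega> \<in> space W \<Longrightarrow> N \<in> null_sets leb01 \<Longrightarrow>
          T \<omega> -` N \<inter> {0..1} \<in> null_sets leb01"
    and countable_A: "countable A"
    and half_open: "\<And>\<omega> a. \<omega> \<in> space W \<Longrightarrow> a \<in> A \<Longrightarrow> half_open_interval (I a \<omega>) \<and> I a \<omega> \<subseteq> {0..1}"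
    and disjoint: "\<And>\<omega>. \<omega> \<in> space W \<Longrightarrow> disjoint_family_on (\<lambda>a. I a \<omega>) A"
    and cover: "\<And>\<omega>. \<omega> \<in> space W \<Longrightarrow> negligible ({0..1} - (\<Union>a\<in>A. I a \<omega>))"
    and branches: "\<And>\<omega> a. \<omega> \<in> space W \<Longrightarrow> a \<in> A \<Longrightarrow> full_branch (Suc l) (T \<omega>) (I a \<omega>)"
    and inv_branch_diff: "\<And>\<omega> a. \<omega> \<in> space W \<Longrightarrow> a \<in> A \<Longrightarrow>
          inv_branch (T \<omega>) (I a \<omega>) differentiable_on {0..1}"
    and transfer_summable: "\<And>\<omega> x. \<omega> \<in> space W \<Longrightarrow> x \<in> {0..1} \<Longrightarrow>
          (\<lambda>a. \<bar>deriv_on {0..1} (inv_branch (T \<omega>) (I a \<omega>)) x\<bar>) summable_on A"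
    and transfer_measurable: "\<And>\<Phi> :: real \<Rightarrow> real. \<Phi> \<in> Cl l \<Longrightarrow>
          (\<lambda>(\<omega>, x). transfer_op A (\<lambda>a. I a \<omega>) (T \<omega>) \<Phi> x) \<in> borel_measurable (W \<Otimes>\<^sub>M leb01)"
    and transfer_integrable: "\<And>\<epsilon> x. \<And>\<Phi> :: real \<Rightarrow> real. \<epsilon> \<in> E \<Longrightarrow> \<Phi> \<in> Cl l \<Longrightarrow> x \<in> {0..1} \<Longrightarrow>
          integrable (P \<epsilon>) (\<lambda>\<omega>. transfer_op A (\<lambda>a. I a \<omega>) (T \<omega>) \<Phi> x)"
    and annealed_Cl: "\<And>\<epsilon>. \<And>\<Phi> :: real \<Rightarrow> real. \<epsilon> \<in> E \<Longrightarrow> \<Phi> \<in> Cl l \<Longrightarrow>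
          annealed_op A I T (P \<epsilon>) \<Phi> \<in> Cl l"
    and annealed_bounded: "\<And>\<epsilon>. \<epsilon> \<in> E \<Longrightarrow>
          \<exists>C. \<forall>\<Phi> \<in> (Cl l :: (real \<Rightarrow> real) set).
            Cl_norm l (annealed_op A I T (P \<epsilon>) \<Phi>) \<le> C * Cl_norm l \<Phi>"

end

theory Submission
  imports Defs
begin

text \<open>
  A stationary density satisfies \<open>L_\<epsilon> h_\<epsilon> = h_\<epsilon>\<close>, hence
  \<open>(I - L_\<epsilon>) (h_\<epsilon> - h_0) = L_\<epsilon> h_0 - h_0 = (\<Sum>i=1..k. \<epsilon>^i / i! G_i) + o(\<epsilon>^k)\<close>.
  Everything in this identity has average zero. Inverting \<open>I - L_\<epsilon>\<close> on functions of average
  zero, where the inverse is bounded uniformly in \<open>\<epsilon>\<close>, preserves the remainder \<open>o(\<epsilon>^k)\<close>.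
  Each \<open>(I - L_\<epsilon>)^(-1) G_i\<close> has an expansion of order \<open>k - i\<close> with coefficients \<open>H_{i,j}\<close>,
  so that its product with \<open>\<epsilon>^i\<close> is known up to \<open>o(\<epsilon>^k)\<close>; collecting equal powers of
  \<open>\<epsilon>\<close> gives the formula (\<open>density_taylor\<close>).

  Three facts carry this computation. The first is that stationarity of the measure with density
  \<open>h_\<epsilon>\<close> gives the pointwise equation \<open>L_\<epsilon> h_\<epsilon> = h_\<epsilon>\<close>, and that \<open>L_\<epsilon>\<close> preserves averages.
  Both follow from the duality \<open>\<integral>_B L_\<epsilon> \<Phi> = \<integral> \<integral>_{T_\<omega>^{-1} B} \<Phi> dP_\<epsilon>(\<omega>)\<close>, which is the change of
  variables formula on each branch (\<open>transfer_duality\<close>, \<open>annealed_duality\<close>,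
  \<open>invariant_density_fixed\<close>, \<open>annealed_integral\<close>).

  The second is that \<open>I - L_\<epsilon>\<close> maps the functions of average zero bijectively onto themselves
  (\<open>I_minus_bij\<close>). It is injective because the eigenspace of the simple eigenvalue \<open>1\<close> is
  spanned by \<open>h_\<epsilon>\<close>, which has average one. By the bound on the inverse it is also bounded from
  below. Since \<open>z - L_\<epsilon>\<close> is invertible for all real \<open>z > 1\<close> by the spectral gap, \<open>1\<close> would
  have to be a boundary point of the spectrum on zero averages if surjectivity failed, and
  boundary points are approximate eigenvalues, contradicting the bound from below
  (\<open>I_minus_surjective_of_bounded_below\<close>). This argument needs that \<open>C^l\<close> is complete
  (\<open>Cl_complete\<close>).

  The third is that Taylor coefficients are unique (\<open>taylor_unique\<close>), so that the derivatives in
  the statement are the coefficients of any expansion found, and that coefficients inherit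
  vanishing averages (\<open>taylor_coeff_integral_zero\<close>), so that the \<open>G_i\<close> with \<open>i \<ge> 1\<close> lie in the
  domain of the inverse.
\<close>

section \<open>The space $C^l([0,1])$ and its norm\<close>

text \<open>
  The iterated derivatives within \<open>[0,1]\<close>, one-sided at the endpoints. Membership in
  \<open>C^l\<close>, its norm and its limits are all statements about the finite sequence of these
  derivatives.
\<close>

abbreviation jet :: "nat \<Rightarrow> (real \<Rightarrow> 'b::real_normed_vector) \<Rightarrow> real \<Rightarrow> 'b" where
  "jet i f \<equiv> (deriv_on {0..1} ^^ i) f"

lemma deriv_on_unit_eq:
  assumes "x \<in> {0..1}" "(f has_vector_derivative d) (at x within {0..1})"
  shows "deriv_on {0..1} f x = d"
  unfolding deriv_on_def
  by (rule vector_derivative_within[OF _ assms(2)])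
     (use assms(1) in \<open>simp add: trivial_limit_within islimpt_Icc\<close>)

text \<open>
  A chain of functions in which each one is the derivative of its predecessor is the sequence
  of iterated derivatives of its first member, because derivatives within \<open>[0,1]\<close> are
  unique. Sums, bounded linear images and limits of elements of \<open>C^l\<close> are treated by
  exhibiting such a chain.
\<close>

lemma jetI:
  assumes der: "\<And>i x. i < k \<Longrightarrow> x \<in> {0..1} \<Longrightarrow>
      (w i has_vector_derivative w (Suc i) x) (at x within {0..1})"
    and cont: "continuous_on {0..1} (w k)"
    and eq: "\<And>x. x \<in> {0..1} \<Longrightarrow> f x = w 0 x"
  shows jetI_Ck_on: "Ck_on k f {0..1}"
    and jetI_eq: "\<And>i x. i \<le> k \<Longrightarrow> x \<in> {0..1} \<Longrightarrow> jet i f x = w i x"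
proof -
  have transfer: "(g has_vector_derivative d) (at x within {0..1})"
    if "(g' has_vector_derivative d) (at x within {0..1})" "\<And>y. y \<in> {0..1} \<Longrightarrow> g y = g' y"
      "x \<in> {0..1}" for g g' :: "real \<Rightarrow> 'a" and d x
    using that by (metis has_vector_derivative_transform)
  show eq': "jet i f x = w i x" if "i \<le> k" "x \<in> {0..1}" for i x
    using that
  proof (induction i arbitrary: x)
    case 0
    then show ?case using eq by simp
  next
    case (Suc i)
    have "(jet i f has_vector_derivative w (Suc i) x) (at x within {0..1})"
      by (rule transfer[OF der]) (use Suc in auto)
    then show ?case using deriv_on_unit_eq Suc.prems by simp
  qed
  have "(jet i f has_vector_derivative w (Suc i) x) (at x within {0..1})"
    if "i < k" "x \<in> {0..1}" for i x
    by (rule transfer[OF der]) (use that eq' in auto)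
  then have "jet i f differentiable (at x within {0..1})" if "i < k" "x \<in> {0..1}" for i x
    using that by (auto simp: has_vector_derivative_def differentiable_def)
  moreover have "continuous_on {0..1} (jet k f)"
    using cont eq' by (subst continuous_on_cong[OF refl, of _ _ "w k"]) auto
  ultimately show "Ck_on k f {0..1}"
    by (auto simp: Ck_on_def)
qed

lemma jet_has_derivative:
  assumes "f \<in> Cl l" "i < l" "x \<in> {0..1}"
  shows "(jet i f has_vector_derivative jet (Suc i) f x) (at x within {0..1})"
proof -
  have "jet i f differentiable (at x within {0..1})"
    using assms by (auto simp: Cl_def Ck_on_def)
  then show ?thesis
    by (simp add: deriv_on_def vector_derivative_works)
qed

lemma jet_continuous:
  assumes "f \<in> Cl l" "i \<le> l"
  shows "continuous_on {0..1} (jet i f)"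
proof (cases "i = l")
  case True
  then show ?thesis using assms by (simp add: Cl_def Ck_on_def)
next
  case False
  then show ?thesis
    using assms by (intro continuous_on_vector_derivative[OF jet_has_derivative]) auto
qed

lemma Cl_outside: "f \<in> Cl l \<Longrightarrow> x \<notin> {0..1} \<Longrightarrow> f x = 0"
  unfolding Cl_def by blast

lemma Cl_jetI:
  assumes "\<And>i x. i < l \<Longrightarrow> x \<in> {0..1} \<Longrightarrow>
      (w i has_vector_derivative w (Suc i) x) (at x within {0..1})"
    and "continuous_on {0..1} (w l)"
    and "\<And>x. x \<in> {0..1} \<Longrightarrow> f x = w 0 x" "\<And>x. x \<notin> {0..1} \<Longrightarrow> f x = 0"
  shows "f \<in> Cl l"
  using jetI_Ck_on[OF assms(1-3)] assms(4) by (auto simp: Cl_def)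

lemma Cl_const: "(\<lambda>x. if x \<in> {0..1} then c else 0) \<in> Cl l"
  by (rule Cl_jetI[where w = "\<lambda>i x. if i = 0 then c else 0"]) auto

lemma
  assumes "f \<in> Cl l" "bounded_linear B"
  shows Cl_bounded_linear: "(\<lambda>x. B (f x)) \<in> Cl l"
    and jet_bounded_linear: "\<And>i x. i \<le> l \<Longrightarrow> x \<in> {0..1} \<Longrightarrow> jet i (\<lambda>x. B (f x)) x = B (jet i f x)"
proof -
  interpret bounded_linear B by fact
  have d: "((\<lambda>x. B (jet i f x)) has_vector_derivative B (jet (Suc i) f x)) (at x within {0..1})"
    if "i < l" "x \<in> {0..1}" for i x
    by (rule has_vector_derivative[OF jet_has_derivative[OF assms(1) that]])
  have c: "continuous_on {0..1} (\<lambda>x. B (jet l f x))"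
    using jet_continuous[OF assms(1)] by (auto intro: continuous_on)
  show "(\<lambda>x. B (f x)) \<in> Cl l"
    by (rule Cl_jetI[where w = "\<lambda>i x. B (jet i f x)"]) (use d c Cl_outside[OF assms(1)] zero in auto)
  show "jet i (\<lambda>x. B (f x)) x = B (jet i f x)" if "i \<le> l" "x \<in> {0..1}" for i x
    by (rule jetI_eq[where w = "\<lambda>i x. B (jet i f x)", OF d c]) (use that in auto)
qed

lemma
  assumes "f \<in> Cl l" "g \<in> Cl l"
  shows Cl_add: "(\<lambda>x. f x + g x) \<in> Cl l"
    and jet_add: "\<And>i x. i \<le> l \<Longrightarrow> x \<in> {0..1} \<Longrightarrow> jet i (\<lambda>x. f x + g x) x = jet i f x + jet i g x"
proof -
  have d: "((\<lambda>x. jet i f x + jet i g x) has_vector_derivative jet (Suc i) f x + jet (Suc i) g x)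
      (at x within {0..1})" if "i < l" "x \<in> {0..1}" for i x
    by (intro has_vector_derivative_add jet_has_derivative[OF assms(1)]
        jet_has_derivative[OF assms(2)] that)
  have c: "continuous_on {0..1} (\<lambda>x. jet l f x + jet l g x)"
    using jet_continuous assms by (auto intro!: continuous_on_add)
  show "(\<lambda>x. f x + g x) \<in> Cl l"
    by (rule Cl_jetI[where w = "\<lambda>i x. jet i f x + jet i g x"])
       (use d c Cl_outside[OF assms(1)] Cl_outside[OF assms(2)] in auto)
  show "jet i (\<lambda>x. f x + g x) x = jet i f x + jet i g x" if "i \<le> l" "x \<in> {0..1}" for i x
    by (rule jetI_eq[where w = "\<lambda>i x. jet i f x + jet i g x", OF d c]) (use that in auto)
qed

lemma Cl_mult_left: "f \<in> Cl l \<Longrightarrow> (\<lambda>x. (c::'a::real_normed_algebra) * f x) \<in> Cl l"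
  by (rule Cl_bounded_linear[OF _ bounded_linear_mult_right])

lemma jet_minus:
  assumes "f \<in> Cl l" "i \<le> l" "x \<in> {0..1}"
  shows "jet i (\<lambda>x. - f x) x = - jet i f x"
  by (rule jet_bounded_linear[OF assms(1) bounded_linear_minus[OF bounded_linear_ident] assms(2,3)])

lemma Cl_minus: "f \<in> Cl l \<Longrightarrow> (\<lambda>x. - f x) \<in> Cl l"
  by (rule Cl_bounded_linear[OF _ bounded_linear_minus[OF bounded_linear_ident]])

lemma Cl_diff: "f \<in> Cl l \<Longrightarrow> g \<in> Cl l \<Longrightarrow> (\<lambda>x. f x - g x) \<in> Cl l"
  using Cl_add[of f l "\<lambda>x. - g x"] Cl_minus[of g l] by simp

lemma jet_diff:
  assumes "f \<in> Cl l" "g \<in> Cl l" "i \<le> l" "x \<in> {0..1}"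
  shows "jet i (\<lambda>x. f x - g x) x = jet i f x - jet i g x"
  using jet_add[OF assms(1) Cl_minus[OF assms(2)] assms(3,4)] jet_minus[OF assms(2-4)] by simp

lemma Cl_zero: "(\<lambda>_. 0) \<in> Cl l"
  using Cl_const[of 0] by simp

lemma Cl_sum: "(\<And>i. i \<in> S \<Longrightarrow> f i \<in> Cl l) \<Longrightarrow> (\<lambda>x. \<Sum>i\<in>S. f i x) \<in> Cl l"
  by (induction S rule: infinite_finite_induct) (auto intro: Cl_add Cl_zero)

lemma jet_bdd_above:
  assumes "f \<in> Cl l" "i \<le> l"
  shows "bdd_above ((\<lambda>x. norm (jet i f x)) ` {0..1})"
  using jet_continuous[OF assms]
  by (intro bounded_imp_bdd_above compact_imp_bounded compact_continuous_image continuous_on_norm) auto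

lemma Cl_norm_nonneg:
  assumes "f \<in> Cl l" shows "0 \<le> Cl_norm l f"
  unfolding Cl_norm_def
proof (rule sum_nonneg)
  fix i assume "i \<in> {..l}"
  have "0 \<le> norm (jet i f 0)" by simp
  also have "\<dots> \<le> (SUP x\<in>{0..1}. norm (jet i f x))"
    by (rule cSUP_upper) (use jet_bdd_above[OF assms] \<open>i \<in> {..l}\<close> in auto)
  finally show "0 \<le> (SUP x\<in>{0..1}. norm (jet i f x))" .
qed

lemma jet_le_Cl_norm:
  assumes "f \<in> Cl l" "i \<le> l" "x \<in> {0..1}"
  shows "norm (jet i f x) \<le> Cl_norm l f"
proof -
  have up: "norm (jet j f y) \<le> (SUP x\<in>{0..1}. norm (jet j f x))" if "j \<le> l" "y \<in> {0..1}" for j y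
    by (rule cSUP_upper) (use jet_bdd_above[OF assms(1)] that in auto)
  have "norm (jet i f x) \<le> (SUP x\<in>{0..1}. norm (jet i f x))" by (rule up) (use assms in auto)
  also have "\<dots> \<le> Cl_norm l f"
    unfolding Cl_norm_def
  proof (rule member_le_sum)
    fix j assume "j \<in> {..l} - {i}"
    then show "0 \<le> (SUP x\<in>{0..1}. norm (jet j f x))"
      using order_trans[OF norm_ge_zero up[of j 0]] by simp
  qed (use assms in auto)
  finally show ?thesis .
qed

lemma norm_le_Cl_norm: "f \<in> Cl l \<Longrightarrow> x \<in> {0..1} \<Longrightarrow> norm (f x) \<le> Cl_norm l f"
  using jet_le_Cl_norm[of f l 0 x] by simp

lemma Cl_norm_le:
  assumes "\<And>i x. i \<le> l \<Longrightarrow> x \<in> {0..1} \<Longrightarrow> norm (jet i f x) \<le> e"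
  shows "Cl_norm l f \<le> real (Suc l) * e"
proof -
  have "Cl_norm l f \<le> (\<Sum>i\<le>l. e)"
    unfolding Cl_norm_def using assms by (intro sum_mono cSUP_least) auto
  then show ?thesis by simp
qed

lemma Cl_norm_add:
  assumes "f \<in> Cl l" "g \<in> Cl l"
  shows "Cl_norm l (\<lambda>x. f x + g x) \<le> Cl_norm l f + Cl_norm l g"
  unfolding Cl_norm_def sum.distrib[symmetric]
proof (intro sum_mono cSUP_least)
  fix i and x :: real assume i: "i \<in> {..l}" and x: "x \<in> {0..1}"
  have "norm (jet i (\<lambda>x. f x + g x) x) \<le> norm (jet i f x) + norm (jet i g x)"
    using jet_add[OF assms] i x norm_triangle_ineq by simp
  also have "\<dots> \<le> (SUP x\<in>{0..1}. norm (jet i f x)) + (SUP x\<in>{0..1}. norm (jet i g x))"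
    using i x jet_bdd_above assms by (intro add_mono cSUP_upper) auto
  finally show "norm (jet i (\<lambda>x. f x + g x) x)
      \<le> (SUP x\<in>{0..1}. norm (jet i f x)) + (SUP x\<in>{0..1}. norm (jet i g x))" .
qed auto

lemma Cl_norm_mult_left:
  fixes f :: "real \<Rightarrow> real"
  assumes "f \<in> Cl l"
  shows "Cl_norm l (\<lambda>x. c * f x) \<le> \<bar>c\<bar> * Cl_norm l f"
  unfolding Cl_norm_def sum_distrib_left
proof (intro sum_mono cSUP_least)
  fix i and x :: real assume i: "i \<in> {..l}" and x: "x \<in> {0..1}"
  have "norm (jet i (\<lambda>x. c * f x) x) = \<bar>c\<bar> * norm (jet i f x)"
    using jet_bounded_linear[OF assms bounded_linear_mult_right, of i x c] i x
    by (simp add: abs_mult)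
  also have "\<dots> \<le> \<bar>c\<bar> * (SUP x\<in>{0..1}. norm (jet i f x))"
    using i x by (intro mult_left_mono cSUP_upper jet_bdd_above[OF assms]) auto
  finally show "norm (jet i (\<lambda>x. c * f x) x) \<le> \<bar>c\<bar> * (SUP x\<in>{0..1}. norm (jet i f x))" .
qed auto

lemma Cl_norm_diff:
  fixes f :: "real \<Rightarrow> real"
  assumes "f \<in> Cl l" "g \<in> Cl l"
  shows "Cl_norm l (\<lambda>x. f x - g x) \<le> Cl_norm l f + Cl_norm l g"
  using Cl_norm_add[OF assms(1) Cl_mult_left[OF assms(2), of "-1"]] Cl_norm_mult_left[OF assms(2), of "-1"]
  by simp

lemma Cl_norm_sum:
  assumes "\<And>i. i \<in> S \<Longrightarrow> f i \<in> Cl l"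
  shows "Cl_norm l (\<lambda>x. \<Sum>i\<in>S. f i x) \<le> (\<Sum>i\<in>S. Cl_norm l (f i :: real \<Rightarrow> real))"
  using assms
proof (induction S rule: infinite_finite_induct)
  case (insert a S)
  then show ?case
    using Cl_norm_add[of "f a" l "\<lambda>x. \<Sum>i\<in>S. f i x"] Cl_sum[of S f l] by simp
qed (use Cl_norm_mult_left[of "\<lambda>_. 0" l 0] in \<open>simp_all add: Cl_zero\<close>)

text \<open>
  Completeness of \<open>C^l\<close>: a Cauchy sequence has uniform limits of all derivatives, and a
  uniform limit of derivatives is the derivative of the limit, so the limits form a chain of
  derivatives. It is used to solve \<open>u - L u = g\<close> by iteration.
\<close>

lemma Cl_complete:
  fixes v :: "nat \<Rightarrow> real \<Rightarrow> 'b::banach"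
  assumes v: "\<And>n. v n \<in> Cl l"
    and Cauchy: "\<And>e. e > 0 \<Longrightarrow> \<exists>N. \<forall>m\<ge>N. \<forall>n\<ge>N. Cl_norm l (\<lambda>x. v m x - v n x) < e"
  obtains u where "u \<in> Cl l" "(\<lambda>n. Cl_norm l (\<lambda>x. v n x - u x)) \<longlonglongrightarrow> 0"
proof -
  have "\<exists>w. uniform_limit {0..1} (\<lambda>n. jet i (v n)) w sequentially" if "i \<le> l" for i
  proof -
    have "uniformly_Cauchy_on {0..1} (\<lambda>n. jet i (v n))"
      unfolding uniformly_Cauchy_on_def
    proof (intro allI impI)
      fix e :: real assume "e > 0"
      then obtain N where N: "\<forall>m\<ge>N. \<forall>n\<ge>N. Cl_norm l (\<lambda>x. v m x - v n x) < e"
        using Cauchy by blast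
      have "dist (jet i (v m) x) (jet i (v n) x) < e" if "x \<in> {0..1}" "m \<ge> N" "n \<ge> N" for x m n
        using jet_le_Cl_norm[OF Cl_diff[OF v v] \<open>i \<le> l\<close> that(1), of m n] N that
        by (fastforce simp: dist_norm jet_diff[OF v v \<open>i \<le> l\<close> that(1)])
      then show "\<exists>N. \<forall>x\<in>{0..1}. \<forall>m\<ge>N. \<forall>n\<ge>N. dist (jet i (v m) x) (jet i (v n) x) < e"
        by blast
    qed
    then show ?thesis
      using uniformly_convergent_eq_Cauchy uniformly_convergent_on_def by metis
  qed
  then obtain w where w: "\<And>i. i \<le> l \<Longrightarrow> uniform_limit {0..1} (\<lambda>n. jet i (v n)) (w i) sequentially"
    by metis
  have der: "(w i has_vector_derivative w (Suc i) x) (at x within {0..1})"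
    if i: "i < l" and x: "x \<in> {0..1}" for i x
  proof -
    have "\<exists>g. \<forall>x\<in>{0..1}. (\<lambda>n. jet i (v n) x) \<longlonglongrightarrow> g x \<and>
        (g has_derivative (\<lambda>h. h *\<^sub>R w (Suc i) x)) (at x within {0..1})"
    proof (rule has_derivative_sequence)
      show "(jet i (v n) has_derivative (\<lambda>h. h *\<^sub>R jet (Suc i) (v n) x)) (at x within {0..1})"
        if "x \<in> {0..1}" for n x
        using jet_has_derivative[OF v i that] by (simp only: has_vector_derivative_def)
      show "(\<lambda>n. jet i (v n) 0) \<longlonglongrightarrow> w i 0"
        using w[of i] i by (intro tendsto_uniform_limitI) auto
      fix e :: real assume "e > 0"
      then have "\<forall>\<^sub>F n in sequentially. \<forall>x\<in>{0..1}. dist (jet (Suc i) (v n) x) (w (Suc i) x) < e"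
        using w[of "Suc i"] i by (intro uniform_limitD) auto
      then show "\<forall>\<^sub>F n in sequentially. \<forall>x\<in>{0..1}. \<forall>h. norm (h *\<^sub>R jet (Suc i) (v n) x - h *\<^sub>R w (Suc i) x) \<le> e * norm h"
      proof (rule eventually_mono, intro ballI allI)
        fix n and x h :: real
        assume "\<forall>x\<in>{0..1}. dist (jet (Suc i) (v n) x) (w (Suc i) x) < e" "x \<in> {0..1}"
        then have "norm (jet (Suc i) (v n) x - w (Suc i) x) \<le> e" by (auto simp: dist_norm intro: less_imp_le)
        then have "\<bar>h\<bar> * norm (jet (Suc i) (v n) x - w (Suc i) x) \<le> \<bar>h\<bar> * e"
          by (rule mult_left_mono) simp
        then show "norm (h *\<^sub>R jet (Suc i) (v n) x - h *\<^sub>R w (Suc i) x) \<le> e * norm h"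
          unfolding scaleR_diff_right[symmetric] norm_scaleR by (simp add: mult.commute)
      qed
    qed auto
    then obtain g where g: "\<And>x. x \<in> {0..1} \<Longrightarrow> (\<lambda>n. jet i (v n) x) \<longlonglongrightarrow> g x"
      "\<And>x. x \<in> {0..1} \<Longrightarrow> (g has_vector_derivative w (Suc i) x) (at x within {0..1})"
      unfolding has_vector_derivative_def by blast
    have "g x = w i x" if "x \<in> {0..1}" for x
      by (rule LIMSEQ_unique[OF g(1)[OF that] tendsto_uniform_limitI[OF w that]]) (use i in auto)
    then show ?thesis
      using g(2)[OF x] x by (metis has_vector_derivative_transform)
  qed
  have cont: "continuous_on {0..1} (w l)"
    by (rule uniform_limit_theorem[OF _ w[of l]]) (auto intro!: always_eventually jet_continuous v)
  define u where "u = (\<lambda>x. if x \<in> {0..1} then w 0 x else 0)"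
  have u: "u \<in> Cl l"
    by (rule Cl_jetI[where w = w]) (use der cont in \<open>auto simp: u_def\<close>)
  have ju: "jet i u x = w i x" if "i \<le> l" "x \<in> {0..1}" for i x
    by (rule jetI_eq[where w = w, OF der cont]) (use that in \<open>auto simp: u_def\<close>)
  have "(\<lambda>n. Cl_norm l (\<lambda>x. v n x - u x)) \<longlonglongrightarrow> 0"
  proof (rule LIMSEQ_I)
    fix e :: real assume e: "e > 0"
    define e' where "e' = e / (2 * real (Suc l))"
    have "e' > 0" using e by (simp add: e'_def)
    have "\<forall>\<^sub>F n in sequentially. \<forall>i\<in>{..l}. \<forall>x\<in>{0..1}. dist (jet i (v n) x) (w i x) < e'"
      using w \<open>e' > 0\<close> by (intro eventually_ball_finite) (auto simp: uniform_limit_iff)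
    then obtain N where N: "\<And>n i x. n \<ge> N \<Longrightarrow> i \<le> l \<Longrightarrow> x \<in> {0..1} \<Longrightarrow> dist (jet i (v n) x) (w i x) < e'"
      unfolding eventually_sequentially by blast
    have "norm (Cl_norm l (\<lambda>x. v n x - u x) - 0) < e" if "n \<ge> N" for n
    proof -
      have "Cl_norm l (\<lambda>x. v n x - u x) \<le> real (Suc l) * e'"
        using N[OF that] by (intro Cl_norm_le) (auto simp: jet_diff[OF v u] ju dist_norm intro: less_imp_le)
      also have "\<dots> < e" using e by (simp add: e'_def del: of_nat_Suc)
      finally show ?thesis using Cl_norm_nonneg[OF Cl_diff[OF v u]] by simp
    qed
    then show "\<exists>N. \<forall>n\<ge>N. norm (Cl_norm l (\<lambda>x. v n x - u x) - 0) < e" by blast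
  qed
  then show ?thesis using that u by blast
qed

section \<open>Integration over the unit interval\<close>

lemma space_leb01 [simp]: "space leb01 = {0..1}"
  by (simp add: leb01_def space_restrict_space)

lemma sets_leb01: "B \<in> sets leb01 \<longleftrightarrow> B \<in> sets borel \<and> B \<subseteq> {0..1}"
  unfolding leb01_def by (subst sets_restrict_space_iff) auto

lemma nn_integral_leb01: "(\<integral>\<^sup>+x. f x \<partial>leb01) = (\<integral>\<^sup>+x. f x * indicator {0..1} x \<partial>lborel)"
  unfolding leb01_def by (rule nn_integral_restrict_space) simp

lemma prob_space_leb01: "prob_space leb01"
  by (rule prob_spaceI) (simp add: leb01_def space_restrict_space emeasure_restrict_space)

lemma measurable_lborel_imp_leb01: "f \<in> borel_measurable borel \<Longrightarrow> f \<in> borel_measurable leb01"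
  unfolding leb01_def by (rule measurable_restrict_space1) simp

lemma AE_leb01_interior: "AE x in leb01. x \<in> {0<..<1}"
proof -
  have "AE x in lborel. x \<noteq> (0::real)" "AE x in lborel. x \<noteq> (1::real)"
    by (auto intro: AE_lborel_singleton)
  then have "AE x in lborel. x \<in> {0..1} \<longrightarrow> x \<in> {0<..<(1::real)}"
    by eventually_elim auto
  then show ?thesis
    unfolding leb01_def by (subst AE_restrict_space_iff) auto
qed

lemma Cl_continuous: "f \<in> Cl l \<Longrightarrow> continuous_on {0..1} f"
  using jet_continuous[of f l 0] by simp

lemma Cl_borel:
  fixes f :: "real \<Rightarrow> real"
  assumes "f \<in> Cl l" shows "f \<in> borel_measurable borel"
proof -
  have "(\<lambda>x. indicator {0..1} x *\<^sub>R f x) \<in> borel_measurable borel"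
    by (intro borel_measurable_continuous_on_indicator Cl_continuous[OF assms]) auto
  also have "(\<lambda>x. indicator {0..1} x *\<^sub>R f x) = f"
    using Cl_outside[OF assms] by (auto simp: indicator_def fun_eq_iff)
  finally show ?thesis .
qed

lemma norm_le_Cl_norm_everywhere: "f \<in> Cl l \<Longrightarrow> norm (f x) \<le> Cl_norm l f"
  using norm_le_Cl_norm[of f l x] Cl_outside[of f l x] Cl_norm_nonneg[of f l]
  by (cases "x \<in> {0..1}") auto

lemma Cl_integrable:
  fixes f :: "real \<Rightarrow> real"
  assumes "f \<in> Cl l" shows "integrable leb01 f"
proof -
  interpret prob_space leb01 by (rule prob_space_leb01)
  show ?thesis
    by (rule integrable_const_bound[where B = "Cl_norm l f"])
       (use norm_le_Cl_norm_everywhere[OF assms] measurable_lborel_imp_leb01[OF Cl_borel[OF assms]] in auto)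
qed

lemma abs_integral_le_Cl_norm:
  fixes f :: "real \<Rightarrow> real"
  assumes "f \<in> Cl l" shows "\<bar>\<integral>x. f x \<partial>leb01\<bar> \<le> Cl_norm l f"
proof -
  interpret prob_space leb01 by (rule prob_space_leb01)
  have "\<bar>\<integral>x. f x \<partial>leb01\<bar> \<le> (\<integral>x. \<bar>f x\<bar> \<partial>leb01)" by (rule integral_abs_bound)
  also have "\<dots> \<le> (\<integral>x. Cl_norm l f \<partial>leb01)"
    using norm_le_Cl_norm_everywhere[OF assms] Cl_integrable[OF assms] by (intro integral_mono) auto
  also have "\<dots> = Cl_norm l f" using prob_space by simp
  finally show ?thesis .
qed

lemma nn_integral_absolutely_integrable:
  fixes F :: "real \<Rightarrow> real"
  assumes F: "F absolutely_integrable_on S" and nn: "\<And>x. x \<in> S \<Longrightarrow> 0 \<le> F x"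
  shows "(\<lambda>x. ennreal (F x) * indicator S x) \<in> borel_measurable lebesgue"
    and "(\<integral>\<^sup>+x. ennreal (F x) * indicator S x \<partial>lebesgue) = ennreal (integral S F)"
proof -
  have eq: "ennreal (F x) * indicator S x = ennreal (indicator S x *\<^sub>R F x)" for x
    by (simp add: indicator_def)
  have int: "integrable lebesgue (\<lambda>x. indicator S x *\<^sub>R F x)"
    using F by (simp add: set_integrable_def)
  then show "(\<lambda>x. ennreal (F x) * indicator S x) \<in> borel_measurable lebesgue"
    unfolding eq by simp
  have "(\<integral>\<^sup>+x. ennreal (F x) * indicator S x \<partial>lebesgue) = ennreal (LINT x:S|lebesgue. F x)"
    unfolding eq set_lebesgue_integral_def
    by (rule nn_integral_eq_integral[OF int]) (use nn in \<open>auto simp: indicator_def\<close>)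
  also have "(LINT x:S|lebesgue. F x) = integral S F"
    using F by (rule set_lebesgue_integral_eq_integral(2))
  finally show "(\<integral>\<^sup>+x. ennreal (F x) * indicator S x \<partial>lebesgue) = ennreal (integral S F)" .
qed

lemma nn_integral_count_space_infsum:
  fixes f :: "'a \<Rightarrow> real"
  assumes "f summable_on A" "\<And>a. a \<in> A \<Longrightarrow> 0 \<le> f a"
  shows "(\<integral>\<^sup>+a. ennreal (f a) \<partial>count_space A) = ennreal (infsum f A)"
proof -
  have "Infinite_Set_Sum.abs_summable_on f A"
    using assms(1) abs_summable_equivalent summable_on_iff_abs_summable_on_real by blast
  then show ?thesis
    by (simp add: nn_integral_conv_infsetsum[OF _ assms(2)] infsetsum_infsum)
qed

section \<open>Duality of transfer operators and composition\<close>

context random_maps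
begin

abbreviation V :: "'a \<Rightarrow> 'w \<Rightarrow> real \<Rightarrow> real" where
  "V a \<omega> \<equiv> inv_branch (T \<omega>) (I a \<omega>)"

abbreviation transfer :: "'w \<Rightarrow> (real \<Rightarrow> 'b::{banach, second_countable_topology}) \<Rightarrow> real \<Rightarrow> 'b" where
  "transfer \<omega> \<equiv> transfer_op A (\<lambda>a. I a \<omega>) (T \<omega>)"

abbreviation L :: "real \<Rightarrow> (real \<Rightarrow> 'b::{banach, second_countable_topology}) \<Rightarrow> real \<Rightarrow> 'b" where
  "L \<epsilon> \<equiv> annealed_op A I T (P \<epsilon>)"

lemma T_measurable: "\<omega> \<in> space W \<Longrightarrow> T \<omega> \<in> leb01 \<rightarrow>\<^sub>M leb01"
  using measurable_Pair2[OF measurable_T, of \<omega>] by simp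

lemma T_vimage_borel:
  assumes "\<omega> \<in> space W" "B \<in> sets borel" "B \<subseteq> {0..1}"
  shows "T \<omega> -` B \<inter> {0..1} \<in> sets borel"
  using measurable_sets[OF T_measurable[OF assms(1)], of B] assms(2,3) by (simp add: sets_leb01)

lemma branch_interval:
  assumes "\<omega> \<in> space W" "a \<in> A"
  shows "I a \<omega> \<in> sets borel" "I a \<omega> \<subseteq> {0..1}"
  using half_open[OF assms] unfolding half_open_interval_def by auto

lemma V_right_inverse:
  assumes "\<omega> \<in> space W" "a \<in> A" "x \<in> {0<..<1}"
  shows "V a \<omega> x \<in> I a \<omega>" "T \<omega> (V a \<omega> x) = x"
proof -
  have "x \<in> T \<omega> ` I a \<omega>"
    using branches[OF assms(1,2)] assms(3) unfolding full_branch_def by blast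
  then show "V a \<omega> x \<in> I a \<omega>" "T \<omega> (V a \<omega> x) = x"
    by (auto simp: inv_branch_def inv_into_into f_inv_into_f)
qed

lemma V_image:
  assumes "\<omega> \<in> space W" "a \<in> A" "B \<subseteq> {0<..<1}"
  shows "V a \<omega> ` B = I a \<omega> \<inter> T \<omega> -` B"
proof -
  have "x \<in> V a \<omega> ` B" if "x \<in> I a \<omega>" "T \<omega> x \<in> B" for x
  proof -
    have "inj_on (T \<omega>) (I a \<omega>)"
      using branches[OF assms(1,2)] by (simp add: full_branch_def)
    moreover have "T \<omega> x \<in> {0<..<1}" using that(2) assms(3) by blast
    ultimately have "V a \<omega> (T \<omega> x) = x"
      using V_right_inverse[OF assms(1,2), of "T \<omega> x"] that(1) by (blast dest: inj_onD)
    then show ?thesis using that(2) imageI[of "T \<omega> x" B "V a \<omega>"] by simp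
  qed
  moreover have "V a \<omega> y \<in> I a \<omega> \<inter> T \<omega> -` B" if "y \<in> B" for y
    using V_right_inverse[OF assms(1,2), of y] subsetD[OF assms(3) that] that by simp
  ultimately show ?thesis by blast
qed

text \<open>
  Only subsets of the open interval are considered, because each of its points has a preimage
  in every branch, whereas an endpoint may be missed. On such a set the
  inverse branch is injective, and the change of variables formula applies to it.
\<close>

lemma branch_change_of_variables:
  assumes \<omega>: "\<omega> \<in> space W" and a: "a \<in> A"
    and \<Phi>: "\<Phi> \<in> Cl l" "\<And>x. x \<in> {0..1} \<Longrightarrow> 0 \<le> \<Phi> x"
    and B: "B \<in> sets borel" "B \<subseteq> {0<..<1}"
  shows "(\<lambda>x. ennreal (\<bar>deriv_on {0..1} (V a \<omega>) x\<bar> * \<Phi> (V a \<omega> x)) * indicator B x)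
      \<in> borel_measurable lebesgue"
    and "(\<integral>\<^sup>+x. ennreal (\<bar>deriv_on {0..1} (V a \<omega>) x\<bar> * \<Phi> (V a \<omega> x)) * indicator B x \<partial>lebesgue)
      = (\<integral>\<^sup>+x. ennreal (\<Phi> x) * indicator (I a \<omega> \<inter> T \<omega> -` B) x \<partial>lborel)"
proof -
  let ?F = "\<lambda>x. \<bar>deriv_on {0..1} (V a \<omega>) x\<bar> * \<Phi> (V a \<omega> x)"
  let ?C = "I a \<omega> \<inter> T \<omega> -` B"
  have B01: "B \<subseteq> {0..1}" using B(2) by auto
  have C: "?C = I a \<omega> \<inter> (T \<omega> -` B \<inter> {0..1})" "?C \<subseteq> {0..1}"
    using branch_interval(2)[OF \<omega> a] by auto
  have C_borel: "?C \<in> sets borel"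
    unfolding C(1) by (intro sets.Int branch_interval(1)[OF \<omega> a] T_vimage_borel[OF \<omega> B(1) B01])
  have "\<Phi> absolutely_integrable_on {0..1}"
    using Cl_continuous[OF \<Phi>(1)] by (rule absolutely_integrable_continuous_real)
  then have int: "\<Phi> absolutely_integrable_on ?C"
    by (rule set_integrable_subset) (use C C_borel in auto)
  have der: "(V a \<omega> has_field_derivative deriv_on {0..1} (V a \<omega>) x) (at x within B)" if "x \<in> B" for x
  proof -
    have "V a \<omega> differentiable (at x within {0..1})"
      using inv_branch_diff[OF \<omega> a] that B01 by (auto simp: differentiable_on_def)
    then have "(V a \<omega> has_vector_derivative deriv_on {0..1} (V a \<omega>) x) (at x within {0..1})"
      by (simp add: deriv_on_def vector_derivative_works)
    then show ?thesis
      using B01 has_vector_derivative_within_subset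
      by (simp add: has_real_derivative_iff_has_vector_derivative) blast
  qed
  have inj: "inj_on (V a \<omega>) B"
    by (rule inj_on_inverseI[where g = "T \<omega>"]) (use V_right_inverse[OF \<omega> a] B(2) in auto)
  have "?F absolutely_integrable_on B \<and> integral B ?F = integral ?C \<Phi>"
    using has_absolute_integral_change_of_variables_1'[OF _ der inj, of \<Phi> "integral ?C \<Phi>"]
      int B(1) V_image[OF \<omega> a B(2)] by auto
  then have F: "?F absolutely_integrable_on B" "integral B ?F = integral ?C \<Phi>" by auto
  have F_nonneg: "0 \<le> ?F x" if "x \<in> B" for x
  proof -
    have "V a \<omega> x \<in> {0..1}"
      using V_right_inverse(1)[OF \<omega> a, of x] branch_interval(2)[OF \<omega> a] that B(2) by blast
    then show ?thesis using \<Phi>(2) by simp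
  qed
  show "(\<lambda>x. ennreal (?F x) * indicator B x) \<in> borel_measurable lebesgue"
    by (rule nn_integral_absolutely_integrable(1)[OF F(1) F_nonneg])
  have "(\<integral>\<^sup>+x. ennreal (?F x) * indicator B x \<partial>lebesgue) = ennreal (integral ?C \<Phi>)"
    using nn_integral_absolutely_integrable(2)[OF F(1) F_nonneg] F(2) by simp
  also have "\<dots> = (\<integral>\<^sup>+x. ennreal (\<Phi> x) * indicator ?C x \<partial>lebesgue)"
    by (rule nn_integral_absolutely_integrable(2)[OF int, symmetric]) (use C(2) \<Phi>(2) in auto)
  also have "\<dots> = (\<integral>\<^sup>+x. ennreal (\<Phi> x) * indicator ?C x \<partial>lborel)"
    by (rule nn_integral_completion)
  finally show "(\<integral>\<^sup>+x. ennreal (?F x) * indicator B x \<partial>lebesgue)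
      = (\<integral>\<^sup>+x. ennreal (\<Phi> x) * indicator ?C x \<partial>lborel)" .
qed

text \<open>
  An element of \<open>C^l\<close> is bounded, so the series that defines the transfer operator is
  dominated by the summable series of the derivatives of the inverse branches.
\<close>

lemma transfer_abs_summable:
  fixes \<Phi> :: "real \<Rightarrow> 'b::{banach, second_countable_topology}"
  assumes "\<omega> \<in> space W" "x \<in> {0..1}" "\<Phi> \<in> Cl l"
  shows "(\<lambda>a. norm (\<bar>deriv_on {0..1} (V a \<omega>) x\<bar> *\<^sub>R \<Phi> (V a \<omega> x))) summable_on A"
proof (rule Infinite_Sum.abs_summable_on_comparison_test')
  show "(\<lambda>a. \<bar>deriv_on {0..1} (V a \<omega>) x\<bar> * Cl_norm l \<Phi>) summable_on A"
    by (rule summable_on_cmult_left[OF transfer_summable[OF assms(1,2)]])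
  show "norm (\<bar>deriv_on {0..1} (V a \<omega>) x\<bar> *\<^sub>R \<Phi> (V a \<omega> x))
      \<le> \<bar>deriv_on {0..1} (V a \<omega>) x\<bar> * Cl_norm l \<Phi>" for a
    using norm_le_Cl_norm_everywhere[OF assms(3)] by (auto intro!: mult_left_mono)
qed

lemmas transfer_summand_summable = abs_summable_summable[OF transfer_abs_summable]

lemma inverse_branch_value_in_unit:
  assumes "\<omega> \<in> space W" "a \<in> A" "x \<in> {0<..<1}"
  shows "V a \<omega> x \<in> {0..1}"
  using V_right_inverse(1)[OF assms] branch_interval(2)[OF assms(1,2)] by blast

lemma transfer_nonneg:
  assumes \<Phi>: "\<Phi> \<in> Cl l" "\<And>x. x \<in> {0..1} \<Longrightarrow> 0 \<le> (\<Phi> x :: real)"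
  shows "0 \<le> transfer \<omega> \<Phi> x"
proof -
  have "0 \<le> \<Phi> y" for y
    using \<Phi>(2)[of y] Cl_outside[OF \<Phi>(1), of y] by (cases "y \<in> {0..1}") auto
  then show ?thesis
    by (auto simp: transfer_op_def intro!: infsum_nonneg)
qed

text \<open>
  The branches are disjoint and cover the unit interval up to a null set, so the identity
  follows from the one for a single branch by summation, which commutes with the integral
  because all terms are nonnegative.
\<close>

lemma transfer_duality:
  assumes \<omega>: "\<omega> \<in> space W"
    and \<Phi>: "\<Phi> \<in> Cl l" "\<And>x. x \<in> {0..1} \<Longrightarrow> 0 \<le> \<Phi> x"
    and B: "B \<in> sets borel" "B \<subseteq> {0<..<1}"
  shows "(\<integral>\<^sup>+x. ennreal (transfer \<omega> \<Phi> x) * indicator B x \<partial>leb01)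
    = (\<integral>\<^sup>+x. ennreal (\<Phi> x) * indicator (T \<omega> -` B) x \<partial>leb01)"
proof -
  let ?F = "\<lambda>a x. \<bar>deriv_on {0..1} (V a \<omega>) x\<bar> * \<Phi> (V a \<omega> x)"
  have B01: "B \<subseteq> {0..1}" using B(2) by auto
  have pointwise: "ennreal (transfer \<omega> \<Phi> x) * indicator B x * indicator {0..1} x
      = (\<integral>\<^sup>+a. ennreal (?F a x) * indicator B x \<partial>count_space A)" for x
  proof (cases "x \<in> B")
    case True
    then have x: "x \<in> {0..1}" "x \<in> {0<..<1}" using B(2) B01 by auto
    have "(\<integral>\<^sup>+a. ennreal (?F a x) \<partial>count_space A) = ennreal (infsum (\<lambda>a. ?F a x) A)"
      using transfer_summand_summable[OF \<omega> x(1) \<Phi>(1)]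
        inverse_branch_value_in_unit[OF \<omega> _ x(2)] \<Phi>(2)
      by (intro nn_integral_count_space_infsum) auto
    then show ?thesis using True x(1) by (simp add: transfer_op_def)
  qed simp
  have sum_ind: "(\<integral>\<^sup>+a. ennreal (\<Phi> x) * indicator (I a \<omega> \<inter> T \<omega> -` B) x \<partial>count_space A)
      = ennreal (\<Phi> x) * indicator (T \<omega> -` B \<inter> (\<Union>a\<in>A. I a \<omega>)) x" for x
  proof (cases "\<exists>b\<in>A. x \<in> I b \<omega>")
    case True
    then obtain b where b: "b \<in> A" "x \<in> I b \<omega>" by blast
    have "x \<in> I a \<omega> \<longleftrightarrow> a = b" if "a \<in> A" for a
      using disjoint[OF \<omega>] b that unfolding disjoint_family_on_def by blast
    then have "(\<integral>\<^sup>+a. ennreal (\<Phi> x) * indicator (I a \<omega> \<inter> T \<omega> -` B) x \<partial>count_space A)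
        = (\<integral>\<^sup>+a. (ennreal (\<Phi> x) * indicator (T \<omega> -` B) x) * indicator {b} a \<partial>count_space A)"
      by (intro nn_integral_cong) (auto simp: indicator_def)
    also have "\<dots> = ennreal (\<Phi> x) * indicator (T \<omega> -` B) x"
      using b(1) by (subst nn_integral_cmult_indicator) auto
    also have "\<dots> = ennreal (\<Phi> x) * indicator (T \<omega> -` B \<inter> (\<Union>a\<in>A. I a \<omega>)) x"
      using b by (auto simp: indicator_def)
    finally show ?thesis .
  next
    case False
    then have "(\<integral>\<^sup>+a. ennreal (\<Phi> x) * indicator (I a \<omega> \<inter> T \<omega> -` B) x \<partial>count_space A)
        = (\<integral>\<^sup>+a. 0 \<partial>count_space A)"
      by (intro nn_integral_cong) (auto simp: indicator_def)
    then show ?thesis using False by (auto simp: indicator_def)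
  qed
  have meas: "(\<lambda>x. ennreal (\<Phi> x) * indicator (I a \<omega> \<inter> T \<omega> -` B) x) \<in> borel_measurable lborel"
    if "a \<in> A" for a
  proof -
    have "I a \<omega> \<inter> T \<omega> -` B = I a \<omega> \<inter> (T \<omega> -` B \<inter> {0..1})"
      using branch_interval(2)[OF \<omega> that] by auto
    then have [measurable]: "I a \<omega> \<inter> T \<omega> -` B \<in> sets borel"
      using branch_interval(1)[OF \<omega> that] T_vimage_borel[OF \<omega> B(1) B01] by auto
    have [measurable]: "\<Phi> \<in> borel_measurable borel" by (rule Cl_borel[OF \<Phi>(1)])
    show ?thesis by measurable
  qed
  have "(\<integral>\<^sup>+x. ennreal (transfer \<omega> \<Phi> x) * indicator B x \<partial>leb01)
      = (\<integral>\<^sup>+x. \<integral>\<^sup>+a. ennreal (?F a x) * indicator B x \<partial>count_space A \<partial>lebesgue)"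
    unfolding nn_integral_leb01 pointwise by (rule nn_integral_completion[symmetric])
  also have "\<dots> = (\<integral>\<^sup>+a. \<integral>\<^sup>+x. ennreal (?F a x) * indicator B x \<partial>lebesgue \<partial>count_space A)"
    by (rule nn_integral_count_space_nn_integral[OF countable_A])
       (rule branch_change_of_variables(1)[OF \<omega> _ \<Phi> B])
  also have "\<dots> = (\<integral>\<^sup>+a. \<integral>\<^sup>+x. ennreal (\<Phi> x) * indicator (I a \<omega> \<inter> T \<omega> -` B) x \<partial>lborel \<partial>count_space A)"
    by (intro nn_integral_cong) (use branch_change_of_variables(2)[OF \<omega> _ \<Phi> B] in simp)
  also have "\<dots> = (\<integral>\<^sup>+x. \<integral>\<^sup>+a. ennreal (\<Phi> x) * indicator (I a \<omega> \<inter> T \<omega> -` B) x \<partial>count_space A \<partial>lborel)"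
    by (rule nn_integral_count_space_nn_integral[OF countable_A meas, symmetric])
  also have "\<dots> = (\<integral>\<^sup>+x. ennreal (\<Phi> x) * indicator (T \<omega> -` B \<inter> (\<Union>a\<in>A. I a \<omega>)) x \<partial>lborel)"
    unfolding sum_ind ..
  also have "\<dots> = (\<integral>\<^sup>+x. ennreal (\<Phi> x) * indicator (T \<omega> -` B) x * indicator {0..1} x \<partial>lborel)"
  proof (rule nn_integral_cong_AE)
    have "(\<Union>a\<in>A. I a \<omega>) \<in> sets borel"
      using branch_interval(1)[OF \<omega>] countable_A by (intro sets.countable_UN') auto
    then have "{0..1} - (\<Union>a\<in>A. I a \<omega>) \<in> null_sets lborel"
      using cover[OF \<omega>] by (auto simp: negligible_iff_null_sets null_sets_completion_iff)
    then show "AE x in lborel. ennreal (\<Phi> x) * indicator (T \<omega> -` B \<inter> (\<Union>a\<in>A. I a \<omega>)) x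
        = ennreal (\<Phi> x) * indicator (T \<omega> -` B) x * indicator {0..1} x"
    proof (rule AE_I', intro subsetI)
      fix x
      assume *: "x \<in> {x \<in> space lborel. ennreal (\<Phi> x) * indicator (T \<omega> -` B \<inter> (\<Union>a\<in>A. I a \<omega>)) x
        \<noteq> ennreal (\<Phi> x) * indicator (T \<omega> -` B) x * indicator {0..1} x}"
      have "(\<Union>a\<in>A. I a \<omega>) \<subseteq> {0..1}" using branch_interval(2)[OF \<omega>] by blast
      then show "x \<in> {0..1} - (\<Union>a\<in>A. I a \<omega>)"
        using * by (cases "x \<in> (\<Union>a\<in>A. I a \<omega>)"; cases "x \<in> {0..1}")
          (auto simp: indicator_inter_arith simp del: UN_iff atLeastAtMost_iff)
    qed
  qed
  also have "\<dots> = (\<integral>\<^sup>+x. ennreal (\<Phi> x) * indicator (T \<omega> -` B) x \<partial>leb01)"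
    unfolding nn_integral_leb01 ..
  finally show ?thesis .
qed

lemma space_P: "\<epsilon> \<in> E \<Longrightarrow> space (P \<epsilon>) = space W"
  by (rule sets_eq_imp_space_eq[OF sets_P])

text \<open>
  Averaging the duality over the random parameter is an application of Tonelli's theorem.
\<close>

lemma annealed_duality:
  assumes \<epsilon>: "\<epsilon> \<in> E"
    and \<Phi>: "\<Phi> \<in> Cl l" "\<And>x. x \<in> {0..1} \<Longrightarrow> 0 \<le> \<Phi> x"
    and B: "B \<in> sets borel" "B \<subseteq> {0<..<1}"
  shows "(\<integral>\<^sup>+x. ennreal (L \<epsilon> \<Phi> x) * indicator B x \<partial>leb01)
    = (\<integral>\<^sup>+\<omega>. \<integral>\<^sup>+x. ennreal (\<Phi> x) * indicator (T \<omega> -` B) x \<partial>leb01 \<partial>P \<epsilon>)"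
proof -
  interpret P: prob_space "P \<epsilon>" by (rule prob[OF \<epsilon>])
  interpret X: prob_space leb01 by (rule prob_space_leb01)
  interpret PX: pair_sigma_finite "P \<epsilon>" leb01 ..
  have "sets (W \<Otimes>\<^sub>M leb01) = sets (P \<epsilon> \<Otimes>\<^sub>M leb01)"
    using sets_P[OF \<epsilon>] by (intro sets_pair_measure_cong) auto
  then have [measurable]: "(\<lambda>(\<omega>, x). transfer \<omega> \<Phi> x) \<in> borel_measurable (P \<epsilon> \<Otimes>\<^sub>M leb01)"
    using transfer_measurable[OF \<Phi>(1)] measurable_cong_sets by blast
  have [measurable]: "B \<in> sets leb01"
    using B unfolding sets_leb01 by auto
  have "(\<integral>\<^sup>+x. ennreal (L \<epsilon> \<Phi> x) * indicator B x \<partial>leb01)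
      = (\<integral>\<^sup>+x. \<integral>\<^sup>+\<omega>. ennreal (transfer \<omega> \<Phi> x) * indicator B x \<partial>P \<epsilon> \<partial>leb01)"
  proof (rule nn_integral_cong)
    fix x assume "x \<in> space leb01"
    then have x: "x \<in> {0..1}" by simp
    have int: "integrable (P \<epsilon>) (\<lambda>\<omega>. transfer \<omega> \<Phi> x)"
      by (rule transfer_integrable[OF \<epsilon> \<Phi>(1) x])
    have "ennreal (L \<epsilon> \<Phi> x) = (\<integral>\<^sup>+\<omega>. ennreal (transfer \<omega> \<Phi> x) \<partial>P \<epsilon>)"
      unfolding annealed_op_def
      by (rule nn_integral_eq_integral[OF int, symmetric]) (use transfer_nonneg[OF \<Phi>] in auto)
    then show "ennreal (L \<epsilon> \<Phi> x) * indicator B x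
        = (\<integral>\<^sup>+\<omega>. ennreal (transfer \<omega> \<Phi> x) * indicator B x \<partial>P \<epsilon>)"
      using int by (simp add: nn_integral_multc)
  qed
  also have "\<dots> = (\<integral>\<^sup>+\<omega>. \<integral>\<^sup>+x. ennreal (transfer \<omega> \<Phi> x) * indicator B x \<partial>leb01 \<partial>P \<epsilon>)"
    by (rule PX.Fubini') measurable
  also have "\<dots> = (\<integral>\<^sup>+\<omega>. \<integral>\<^sup>+x. ennreal (\<Phi> x) * indicator (T \<omega> -` B) x \<partial>leb01 \<partial>P \<epsilon>)"
    by (intro nn_integral_cong transfer_duality \<Phi> B) (use space_P[OF \<epsilon>] in auto)
  finally show ?thesis .
qed

end

section \<open>Fixed densities, averages and linearity of the annealed operator\<close>

text \<open>
  Equal integrals over all Borel sets give equality almost everywhere; for continuous functions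
  the exceptional set is open in the open interval and null, hence empty, and the endpoints
  follow by continuity.
\<close>

lemma Cl_eqI_nn_integral:
  fixes f g :: "real \<Rightarrow> real"
  assumes f: "f \<in> Cl l" and g: "g \<in> Cl l"
    and nonneg: "\<And>x. x \<in> {0..1} \<Longrightarrow> 0 \<le> f x" "\<And>x. x \<in> {0..1} \<Longrightarrow> 0 \<le> g x"
    and eq: "\<And>B. B \<in> sets borel \<Longrightarrow> B \<subseteq> {0<..<1} \<Longrightarrow>
      (\<integral>\<^sup>+x. ennreal (f x) * indicator B x \<partial>leb01) = (\<integral>\<^sup>+x. ennreal (g x) * indicator B x \<partial>leb01)"
  shows "f = g"
proof -
  interpret prob_space leb01 by (rule prob_space_leb01)
  let ?U = "{0<..<1::real}"
  have [measurable]: "f \<in> borel_measurable leb01" "g \<in> borel_measurable leb01" "?U \<in> sets leb01"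
    using measurable_lborel_imp_leb01 Cl_borel f g by (auto simp: sets_leb01)
  define F where "F u x = ennreal (u x) * indicator ?U x" for u :: "real \<Rightarrow> real" and x
  have F_meas: "F f \<in> borel_measurable leb01" "F g \<in> borel_measurable leb01"
    unfolding F_def[abs_def] by measurable
  have F_ind: "F u x * indicator B x = ennreal (u x) * indicator (B \<inter> ?U) x" for u x B
    by (cases "x \<in> B"; cases "x \<in> ?U") (simp_all add: F_def del: greaterThanLessThan_iff)
  have "AE x in leb01. F f x = F g x"
  proof (rule density_unique2[OF F_meas])
    fix B :: "real set" assume "B \<in> sets leb01"
    then show "(\<integral>\<^sup>+x. F f x * indicator B x \<partial>leb01) = (\<integral>\<^sup>+x. F g x * indicator B x \<partial>leb01)"
      unfolding F_ind by (intro eq) (auto simp: sets_leb01)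
  qed
  then have "AE x in lborel. x \<in> {0..1} \<longrightarrow> F f x = F g x"
    unfolding leb01_def by (subst (asm) AE_restrict_space_iff) auto
  then have "AE x in lborel. x \<notin> {x \<in> ?U. f x - g x \<noteq> 0}"
    by eventually_elim (use nonneg in \<open>auto simp: F_def\<close>)
  moreover have cont: "continuous_on {0..1} (\<lambda>x. f x - g x)"
    by (intro continuous_on_diff Cl_continuous[OF f] Cl_continuous[OF g])
  then have "continuous_on ?U (\<lambda>x. f x - g x)"
    by (rule continuous_on_subset) auto
  then have op: "open {x \<in> ?U. f x - g x \<noteq> 0}"
    using continuous_open_preimage[of ?U "\<lambda>x. f x - g x" "- {0}"]
    by (simp add: vimage_def Int_def open_Compl)
  ultimately have "{x \<in> ?U. f x - g x \<noteq> 0} \<in> null_sets lborel"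
    by (subst AE_iff_null_sets) auto
  then have "negligible {x \<in> ?U. f x - g x \<noteq> 0}"
    by (simp add: negligible_iff_null_sets null_sets_completionI del: mem_Collect_eq)
  then have "{x \<in> ?U. f x - g x \<noteq> 0} = {}"
    using open_not_negligible[OF op] by blast
  then have zero: "f x - g x = 0" if "x \<in> ?U" for x
    using that by blast
  have "f x = g x" if "x \<in> {0..1}" for x
    using continuous_constant_on_closure[of ?U "\<lambda>x. f x - g x" 0 x] cont zero that by simp
  then show ?thesis
    using Cl_outside[OF f] Cl_outside[OF g] by (intro ext) (metis)
qed

context random_maps
begin

lemma annealed_nonneg:
  assumes \<Phi>: "\<Phi> \<in> Cl l" "\<And>x. x \<in> {0..1} \<Longrightarrow> 0 \<le> (\<Phi> x :: real)"
  shows "0 \<le> L \<epsilon> \<Phi> x"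
  unfolding annealed_op_def by (rule Bochner_Integration.integral_nonneg) (rule transfer_nonneg[OF \<Phi>])

text \<open>
  Stationarity is a statement about measures. By duality, the integrals of \<open>L h\<close> and of
  \<open>h\<close> agree on all Borel subsets of the open interval, which determines both continuous
  functions.
\<close>

lemma invariant_density_fixed:
  assumes \<epsilon>: "\<epsilon> \<in> E" and h: "h \<in> Cl l" "invariant_density T (P \<epsilon>) h"
  shows "L \<epsilon> h = h"
proof (rule Cl_eqI_nn_integral)
  have nonneg: "0 \<le> h x" if "x \<in> {0..1}" for x
    using h(2) that unfolding invariant_density_def by blast
  then show "0 \<le> h x" if "x \<in> {0..1}" for x using that .
  show "0 \<le> L \<epsilon> h x" for x by (rule annealed_nonneg[OF h(1) nonneg])
  show "L \<epsilon> h \<in> Cl l" "h \<in> Cl l" using annealed_Cl[OF \<epsilon> h(1)] h(1) by auto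
  fix B :: "real set" assume B: "B \<in> sets borel" "B \<subseteq> {0<..<1}"
  then have B': "B \<subseteq> {0..1}" "B \<in> sets leb01" by (auto simp: sets_leb01)
  have [measurable]: "h \<in> borel_measurable leb01"
    by (rule measurable_lborel_imp_leb01[OF Cl_borel[OF h(1)]])
  have em: "emeasure (density leb01 (\<lambda>x. ennreal (h x))) C
      = (\<integral>\<^sup>+x. ennreal (h x) * indicator C x \<partial>leb01)" if "C \<in> sets leb01" for C
    using that by (intro emeasure_density) auto
  have "(\<integral>\<^sup>+x. ennreal (L \<epsilon> h x) * indicator B x \<partial>leb01)
      = (\<integral>\<^sup>+\<omega>. \<integral>\<^sup>+x. ennreal (h x) * indicator (T \<omega> -` B) x \<partial>leb01 \<partial>P \<epsilon>)"
    by (rule annealed_duality[OF \<epsilon> h(1) nonneg B])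
  also have "\<dots> = (\<integral>\<^sup>+\<omega>. emeasure (density leb01 (\<lambda>x. ennreal (h x))) (T \<omega> -` B \<inter> {0..1}) \<partial>P \<epsilon>)"
  proof (intro nn_integral_cong)
    fix \<omega> assume "\<omega> \<in> space (P \<epsilon>)"
    then have "T \<omega> -` B \<inter> {0..1} \<in> sets leb01"
      using T_vimage_borel[of \<omega>, OF _ B(1) B'(1)] space_P[OF \<epsilon>] by (simp add: sets_leb01)
    then show "(\<integral>\<^sup>+x. ennreal (h x) * indicator (T \<omega> -` B) x \<partial>leb01)
        = emeasure (density leb01 (\<lambda>x. ennreal (h x))) (T \<omega> -` B \<inter> {0..1})"
      by (subst em) (auto intro!: nn_integral_cong simp: indicator_def)
  qed
  also have "\<dots> = emeasure (density leb01 (\<lambda>x. ennreal (h x))) B"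
    using h(2) B'(2) unfolding invariant_density_def Let_def by simp
  finally show "(\<integral>\<^sup>+x. ennreal (L \<epsilon> h x) * indicator B x \<partial>leb01)
      = (\<integral>\<^sup>+x. ennreal (h x) * indicator B x \<partial>leb01)"
    using em[OF B'(2)] by simp
qed

lemma invariant_density_integral:
  assumes h: "h \<in> Cl l" "invariant_density T (P \<epsilon>) h"
  shows "(\<integral>x. h x \<partial>leb01) = 1"
proof -
  have nonneg: "0 \<le> h x" if "x \<in> {0..1}" for x
    using h(2) that unfolding invariant_density_def by blast
  have [measurable]: "h \<in> borel_measurable leb01"
    by (rule measurable_lborel_imp_leb01[OF Cl_borel[OF h(1)]])
  interpret H: prob_space "density leb01 (\<lambda>x. ennreal (h x))"
    using h(2) unfolding invariant_density_def Let_def by blast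
  have "(\<integral>\<^sup>+x. ennreal (h x) \<partial>leb01) = emeasure (density leb01 (\<lambda>x. ennreal (h x))) (space leb01)"
    by (subst emeasure_density) (auto intro!: nn_integral_cong simp del: space_leb01)
  also have "\<dots> = 1"
    using H.emeasure_space_1 by simp
  finally have "(\<integral>\<^sup>+x. ennreal (h x) \<partial>leb01) = 1" .
  then show ?thesis
    by (subst integral_eq_nn_integral) (auto intro!: AE_I2 nonneg)
qed

text \<open>
  This is duality for the whole open interval. Its preimage misses only points that are mapped
  to an endpoint, and these form a null set by non-singularity.
\<close>

lemma annealed_integral_nonneg:
  assumes \<epsilon>: "\<epsilon> \<in> E" and \<Phi>: "\<Phi> \<in> Cl l" "\<And>x. x \<in> {0..1} \<Longrightarrow> 0 \<le> (\<Phi> x :: real)"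
  shows "(\<integral>x. L \<epsilon> \<Phi> x \<partial>leb01) = (\<integral>x. \<Phi> x \<partial>leb01)"
proof -
  interpret P: prob_space "P \<epsilon>" by (rule prob[OF \<epsilon>])
  let ?U = "{0<..<1::real}"
  have "(\<integral>\<^sup>+x. ennreal (L \<epsilon> \<Phi> x) \<partial>leb01) = (\<integral>\<^sup>+x. ennreal (L \<epsilon> \<Phi> x) * indicator ?U x \<partial>leb01)"
    by (intro nn_integral_cong_AE eventually_mono[OF AE_leb01_interior]) simp
  also have "\<dots> = (\<integral>\<^sup>+\<omega>. \<integral>\<^sup>+x. ennreal (\<Phi> x) * indicator (T \<omega> -` ?U) x \<partial>leb01 \<partial>P \<epsilon>)"
    by (rule annealed_duality[OF \<epsilon> \<Phi>]) auto
  also have "\<dots> = (\<integral>\<^sup>+\<omega>. \<integral>\<^sup>+x. ennreal (\<Phi> x) \<partial>leb01 \<partial>P \<epsilon>)"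
  proof (rule nn_integral_cong)
    fix \<omega> assume "\<omega> \<in> space (P \<epsilon>)"
    then have \<omega>: "\<omega> \<in> space W" using space_P[OF \<epsilon>] by simp
    have "{0, 1} \<in> null_sets leb01"
      unfolding leb01_def by (subst null_sets_restrict_space) (auto intro!: null_setsI emeasure_lborel_countable)
    then have "T \<omega> -` {0, 1} \<inter> {0..1} \<in> null_sets leb01"
      by (rule nonsingular[OF \<omega>])
    then have "AE x in leb01. x \<notin> T \<omega> -` {0, 1} \<inter> {0..1}"
      by (rule AE_not_in)
    with AE_space have "AE x in leb01. ennreal (\<Phi> x) * indicator (T \<omega> -` ?U) x = ennreal (\<Phi> x)"
    proof eventually_elim
      case (elim x)
      note x = elim
      have "T \<omega> x \<in> {0..1}"
        using measurable_space[OF T_measurable[OF \<omega>] x(1)] by simp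
      then have "x \<in> T \<omega> -` ?U" using x by (auto simp: less_le)
      then show "ennreal (\<Phi> x) * indicator (T \<omega> -` ?U) x = ennreal (\<Phi> x)"
        by (simp del: vimage_eq)
    qed
    then show "(\<integral>\<^sup>+x. ennreal (\<Phi> x) * indicator (T \<omega> -` ?U) x \<partial>leb01) = (\<integral>\<^sup>+x. ennreal (\<Phi> x) \<partial>leb01)"
      by (rule nn_integral_cong_AE)
  qed
  also have "\<dots> = (\<integral>\<^sup>+x. ennreal (\<Phi> x) \<partial>leb01)"
    by (simp add: P.emeasure_space_1)
  finally have "(\<integral>\<^sup>+x. ennreal (L \<epsilon> \<Phi> x) \<partial>leb01) = (\<integral>\<^sup>+x. ennreal (\<Phi> x) \<partial>leb01)" .
  moreover have "L \<epsilon> \<Phi> \<in> borel_measurable leb01" "\<Phi> \<in> borel_measurable leb01"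
    using measurable_lborel_imp_leb01 Cl_borel \<Phi>(1) annealed_Cl[OF \<epsilon> \<Phi>(1)] by auto
  ultimately show ?thesis
    using annealed_nonneg[OF \<Phi>] \<Phi>(2)
    by (subst (1 2) integral_eq_nn_integral) (auto intro!: AE_I2)
qed

lemma transfer_add:
  fixes u v :: "real \<Rightarrow> real"
  assumes "\<omega> \<in> space W" "x \<in> {0..1}" "u \<in> Cl l" "v \<in> Cl l"
  shows "transfer \<omega> (\<lambda>x. u x + v x) x = transfer \<omega> u x + transfer \<omega> v x"
  using infsum_add[OF transfer_summand_summable[OF assms(1-3)] transfer_summand_summable[OF assms(1,2,4)]]
    assms(2) by (simp add: transfer_op_def distrib_left)

lemma annealed_outside: "x \<notin> {0..1} \<Longrightarrow> L \<epsilon> u x = 0"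
  by (auto simp: annealed_op_def transfer_op_def)

lemma annealed_add:
  fixes u v :: "real \<Rightarrow> real"
  assumes \<epsilon>: "\<epsilon> \<in> E" and u: "u \<in> Cl l" and v: "v \<in> Cl l"
  shows "L \<epsilon> (\<lambda>x. u x + v x) = (\<lambda>x. L \<epsilon> u x + L \<epsilon> v x)"
proof
  fix x
  show "L \<epsilon> (\<lambda>x. u x + v x) x = L \<epsilon> u x + L \<epsilon> v x"
  proof (cases "x \<in> {0..1}")
    case True
    have "L \<epsilon> (\<lambda>x. u x + v x) x = (\<integral>\<omega>. transfer \<omega> u x + transfer \<omega> v x \<partial>P \<epsilon>)"
      unfolding annealed_op_def
      by (intro Bochner_Integration.integral_cong refl transfer_add True u v) (simp add: space_P[OF \<epsilon>])
    also have "\<dots> = L \<epsilon> u x + L \<epsilon> v x"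
      unfolding annealed_op_def
      by (intro Bochner_Integration.integral_add transfer_integrable[OF \<epsilon> _ True] u v)
    finally show ?thesis .
  qed (simp add: annealed_outside)
qed

lemma annealed_mult_left:
  fixes u :: "real \<Rightarrow> real"
  shows "L \<epsilon> (\<lambda>x. c * u x) = (\<lambda>x. c * L \<epsilon> u x)"
proof -
  have "transfer \<omega> (\<lambda>x. c * u x) x = c * transfer \<omega> u x" for \<omega> x
    by (simp add: transfer_op_def mult.left_commute[of _ c] infsum_cmult_right')
  then show ?thesis
    by (simp add: annealed_op_def fun_eq_iff)
qed

lemma annealed_diff:
  fixes u v :: "real \<Rightarrow> real"
  assumes \<epsilon>: "\<epsilon> \<in> E" and u: "u \<in> Cl l" and v: "v \<in> Cl l"
  shows "L \<epsilon> (\<lambda>x. u x - v x) = (\<lambda>x. L \<epsilon> u x - L \<epsilon> v x)"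
  using annealed_add[OF \<epsilon> u Cl_mult_left[OF v, of "-1"]] annealed_mult_left[of \<epsilon> "-1" v] by simp

lemma annealed_integral:
  fixes \<Phi> :: "real \<Rightarrow> real"
  assumes \<epsilon>: "\<epsilon> \<in> E" and \<Phi>: "\<Phi> \<in> Cl l"
  shows "(\<integral>x. L \<epsilon> \<Phi> x \<partial>leb01) = (\<integral>x. \<Phi> x \<partial>leb01)"
proof -
  \<comment> \<open>Adding a constant that dominates the function reduces the claim to nonnegative functions.\<close>
  define k :: "real \<Rightarrow> real" where "k = (\<lambda>x. if x \<in> {0..1} then Cl_norm l \<Phi> else 0)"
  have k: "k \<in> Cl l" unfolding k_def by (rule Cl_const)
  have k_nonneg: "0 \<le> k x" for x using Cl_norm_nonneg[OF \<Phi>] by (simp add: k_def)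
  have sum_nonneg: "0 \<le> \<Phi> x + k x" if "x \<in> {0..1}" for x
    using norm_le_Cl_norm[OF \<Phi> that] that by (simp add: k_def)
  have "(\<integral>x. L \<epsilon> \<Phi> x \<partial>leb01) + (\<integral>x. L \<epsilon> k x \<partial>leb01) = (\<integral>x. L \<epsilon> (\<lambda>x. \<Phi> x + k x) x \<partial>leb01)"
    unfolding annealed_add[OF \<epsilon> \<Phi> k]
    by (intro Bochner_Integration.integral_add[symmetric] Cl_integrable[OF annealed_Cl[OF \<epsilon>]] \<Phi> k)
  also have "\<dots> = (\<integral>x. \<Phi> x + k x \<partial>leb01)"
    by (rule annealed_integral_nonneg[OF \<epsilon> Cl_add[OF \<Phi> k] sum_nonneg])
  also have "\<dots> = (\<integral>x. \<Phi> x \<partial>leb01) + (\<integral>x. k x \<partial>leb01)"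
    by (intro Bochner_Integration.integral_add Cl_integrable[OF \<Phi>] Cl_integrable[OF k])
  finally show ?thesis
    using annealed_integral_nonneg[OF \<epsilon> k k_nonneg] by simp
qed

lemma transfer_bounded_linear:
  fixes u :: "real \<Rightarrow> 'b::{banach, second_countable_topology}"
    and B :: "'b \<Rightarrow> 'c::{banach, second_countable_topology}"
  assumes "\<omega> \<in> space W" "u \<in> Cl l" "bounded_linear B"
  shows "transfer \<omega> (\<lambda>x. B (u x)) x = B (transfer \<omega> u x)"
proof (cases "x \<in> {0..1}")
  case True
  interpret bounded_linear B by fact
  show ?thesis
    using infsumI[OF has_sum_bounded_linear[OF assms(3)
        has_sum_infsum[OF transfer_summand_summable[OF assms(1) True assms(2)]]]] True
    by (simp add: transfer_op_def scaleR o_def)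
next
  case False
  interpret bounded_linear B by fact
  show ?thesis using False by (auto simp: transfer_op_def zero)
qed

text \<open>
  The spectrum concerns complex functions, the invariant densities are real. Real-linear
  functionals of the values, such as the real part, commute with the operator, and so does
  the inclusion of real functions; this carries spectral information to the real operator.
\<close>

lemma annealed_complex_bounded_linear:
  fixes u :: "real \<Rightarrow> complex" and B :: "complex \<Rightarrow> real"
  assumes \<epsilon>: "\<epsilon> \<in> E" and u: "u \<in> Cl l" and B: "bounded_linear B"
  shows "L \<epsilon> (\<lambda>x. B (u x)) = (\<lambda>x. B (L \<epsilon> u x))"
proof
  fix x
  interpret bounded_linear B by fact
  show "L \<epsilon> (\<lambda>x. B (u x)) x = B (L \<epsilon> u x)"
  proof (cases "x \<in> {0..1}")
    case True
    have part: "integrable (P \<epsilon>) (\<lambda>\<omega>. C (transfer \<omega> u x))" if "bounded_linear C" for C :: "complex \<Rightarrow> real"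
    proof -
      have "integrable (P \<epsilon>) (\<lambda>\<omega>. transfer \<omega> (\<lambda>x. C (u x)) x)"
        by (rule transfer_integrable[OF \<epsilon> Cl_bounded_linear[OF u that] True])
      also have "?this \<longleftrightarrow> integrable (P \<epsilon>) (\<lambda>\<omega>. C (transfer \<omega> u x))"
        by (rule Bochner_Integration.integrable_cong)
           (simp_all add: transfer_bounded_linear[OF _ u that] space_P[OF \<epsilon>])
      finally show ?thesis .
    qed
    have "integrable (P \<epsilon>) (\<lambda>\<omega>. complex_of_real (Re (transfer \<omega> u x)) + \<i> * complex_of_real (Im (transfer \<omega> u x)))"
      by (intro Bochner_Integration.integrable_add integrable_mult_right integrable_of_real part
          bounded_linear_Re bounded_linear_Im)
    then have int: "integrable (P \<epsilon>) (\<lambda>\<omega>. transfer \<omega> u x)"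
      by (simp add: complex_eq[symmetric])
    have "L \<epsilon> (\<lambda>x. B (u x)) x = (\<integral>\<omega>. B (transfer \<omega> u x) \<partial>P \<epsilon>)"
      unfolding annealed_op_def
      by (rule Bochner_Integration.integral_cong)
         (simp_all add: transfer_bounded_linear[OF _ u B] space_P[OF \<epsilon>])
    also have "\<dots> = B (L \<epsilon> u x)"
      unfolding annealed_op_def by (rule integral_bounded_linear[OF B int])
    finally show ?thesis .
  qed (simp add: annealed_outside zero)
qed

lemma annealed_of_real:
  fixes u :: "real \<Rightarrow> real"
  assumes \<epsilon>: "\<epsilon> \<in> E" and u: "u \<in> Cl l"
  shows "L \<epsilon> (\<lambda>x. complex_of_real (u x)) = (\<lambda>x. complex_of_real (L \<epsilon> u x))"
proof
  fix x
  have "L \<epsilon> (\<lambda>x. complex_of_real (u x)) x = (\<integral>\<omega>. complex_of_real (transfer \<omega> u x) \<partial>P \<epsilon>)"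
    unfolding annealed_op_def
    by (rule Bochner_Integration.integral_cong)
       (simp_all add: transfer_bounded_linear[OF _ u bounded_linear_of_real] space_P[OF \<epsilon>])
  then show "L \<epsilon> (\<lambda>x. complex_of_real (u x)) x = complex_of_real (L \<epsilon> u x)"
    by (simp add: annealed_op_def)
qed

end

section \<open>Taylor expansions at zero\<close>

lemma smallo_dominated:
  fixes f g :: "real \<Rightarrow> real"
  assumes "\<forall>\<^sub>F x in F. \<bar>f x\<bar> \<le> \<bar>g x\<bar>" "g \<in> o[F](h)"
  shows "f \<in> o[F](h)"
proof -
  have "f \<in> O[F](g)" by (rule bigoI[of _ 1]) (use assms(1) in simp)
  then show ?thesis using assms(2) by (rule landau_o.big_small_trans)
qed

lemma power_bigo_power:
  assumes "n \<le> k"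
  shows "(\<lambda>\<epsilon>::real. \<epsilon> ^ k) \<in> O[at 0 within E](\<lambda>\<epsilon>. \<epsilon> ^ n)"
proof (rule bigoI[of _ 1])
  have "\<forall>\<^sub>F \<epsilon> in at 0 within E. \<bar>\<epsilon>\<bar> < (1::real)"
    unfolding eventually_at by (intro exI[of _ 1]) auto
  then show "\<forall>\<^sub>F \<epsilon>::real in at 0 within E. norm (\<epsilon> ^ k) \<le> 1 * norm (\<epsilon> ^ n)"
    by eventually_elim (use assms in \<open>auto simp: power_abs intro: power_decreasing\<close>)
qed

lemma power_smallo_power:
  assumes "n < k"
  shows "(\<lambda>\<epsilon>::real. \<epsilon> ^ k) \<in> o[at 0 within E](\<lambda>\<epsilon>. \<epsilon> ^ n)"
proof -
  have "(\<lambda>\<epsilon>::real. \<epsilon>) \<in> o[at 0 within E](\<lambda>_. 1)"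
    by (rule smalloI_tendsto) (auto intro: tendsto_ident_at)
  then have "(\<lambda>\<epsilon>::real. \<epsilon> ^ n * \<epsilon>) \<in> o[at 0 within E](\<lambda>\<epsilon>. \<epsilon> ^ n * 1)"
    by (intro landau_o.big_small_mult) auto
  then have "(\<lambda>\<epsilon>::real. \<epsilon> ^ Suc n) \<in> o[at 0 within E](\<lambda>\<epsilon>. \<epsilon> ^ n)"
    by (simp add: mult.commute)
  moreover have "(\<lambda>\<epsilon>::real. \<epsilon> ^ k) \<in> O[at 0 within E](\<lambda>\<epsilon>. \<epsilon> ^ Suc n)"
    using assms by (intro power_bigo_power) simp
  ultimately show ?thesis by (rule landau_o.big_small_trans[rotated])
qed

text \<open>
  Dividing by \<open>\<epsilon>^n\<close>, where \<open>n\<close> is the smallest index with a possibly nonzero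
  coefficient, and letting \<open>\<epsilon>\<close> tend to zero within \<open>E\<close> isolates that coefficient.
\<close>

lemma polynomial_smallo_imp_zero:
  fixes a :: "nat \<Rightarrow> real"
  assumes lim: "0 islimpt E"
    and small: "(\<lambda>\<epsilon>. \<Sum>n\<le>k. a n * \<epsilon> ^ n) \<in> o[at 0 within E](\<lambda>\<epsilon>. \<epsilon> ^ k)"
    and "n \<le> k"
  shows "a n = 0"
  using \<open>n \<le> k\<close>
proof (induction n rule: less_induct)
  case (less n)
  have "(\<lambda>\<epsilon>. \<Sum>m\<le>k. a m * \<epsilon> ^ m) \<in> o[at 0 within E](\<lambda>\<epsilon>. \<epsilon> ^ n)"
    by (rule landau_o.small_big_trans[OF small power_bigo_power[OF less.prems]])
  then have "((\<lambda>\<epsilon>. (\<Sum>m\<le>k. a m * \<epsilon> ^ m) / \<epsilon> ^ n) \<longlongrightarrow> 0) (at 0 within E)"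
    by (rule smalloD_tendsto)
  moreover have ev: "\<forall>\<^sub>F \<epsilon> in at 0 within E. (\<Sum>m\<le>k. a m * \<epsilon> ^ m) / \<epsilon> ^ n = (\<Sum>m=n..k. a m * \<epsilon> ^ (m - n))"
    unfolding eventually_at_filter
  proof (intro always_eventually allI impI)
    fix \<epsilon> :: real assume "\<epsilon> \<noteq> 0"
    have "(\<Sum>m\<le>k. a m * \<epsilon> ^ m) = (\<Sum>m=n..k. a m * \<epsilon> ^ m)"
      by (rule sum.mono_neutral_right) (use less in auto)
    also have "\<dots> = (\<Sum>m=n..k. a m * \<epsilon> ^ (m - n)) * \<epsilon> ^ n"
      by (simp add: sum_distrib_right mult.assoc flip: power_add)
    finally show "(\<Sum>m\<le>k. a m * \<epsilon> ^ m) / \<epsilon> ^ n = (\<Sum>m=n..k. a m * \<epsilon> ^ (m - n))"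
      using \<open>\<epsilon> \<noteq> 0\<close> by simp
  qed
  ultimately have lim0: "((\<lambda>\<epsilon>. \<Sum>m=n..k. a m * \<epsilon> ^ (m - n)) \<longlongrightarrow> 0) (at 0 within E)"
    by (simp only: tendsto_cong[OF ev])
  have lim_val: "((\<lambda>\<epsilon>. \<Sum>m=n..k. a m * \<epsilon> ^ (m - n)) \<longlongrightarrow> (\<Sum>m=n..k. a m * 0 ^ (m - n))) (at 0 within E)"
    by (intro tendsto_intros)
  have "at 0 within E \<noteq> bot" using lim by (simp add: trivial_limit_within)
  then have "(\<Sum>m=n..k. a m * 0 ^ (m - n)) = 0"
    by (rule tendsto_unique[OF _ lim_val lim0])
  moreover have "(\<Sum>m=n..k. a m * 0 ^ (m - n)) = (\<Sum>m\<in>{n}. a m * 0 ^ (m - n))"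
    by (rule sum.mono_neutral_right) (use less.prems in auto)
  ultimately show ?case by simp
qed

lemma taylor_poly_Cl:
  assumes "\<And>n. n \<le> k \<Longrightarrow> c n \<in> Cl l"
  shows "(\<lambda>x. \<Sum>n\<le>k. \<epsilon> ^ n / fact n * c n x :: real) \<in> Cl l"
  by (intro Cl_sum Cl_mult_left assms) auto

text \<open>
  A functional of norm at most one turns an expansion in \<open>C^l\<close> into a scalar expansion.
  Evaluation at a point gives uniqueness of the coefficients; integration determines their
  averages.
\<close>

lemma taylor_functional:
  assumes taylor: "taylor_at_0 l E k F c"
    and bound: "\<And>u. u \<in> Cl l \<Longrightarrow> \<bar>\<phi> u\<bar> \<le> Cl_norm l u"
    and lin: "\<And>\<epsilon>. F \<epsilon> \<in> Cl l \<Longrightarrow>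
      \<phi> (\<lambda>x. F \<epsilon> x - (\<Sum>n\<le>k. \<epsilon> ^ n / fact n * c n x)) = \<phi> (F \<epsilon>) - (\<Sum>n\<le>k. \<epsilon> ^ n / fact n * \<phi> (c n))"
  shows "(\<lambda>\<epsilon>. \<phi> (F \<epsilon>) - (\<Sum>n\<le>k. \<epsilon> ^ n / fact n * \<phi> (c n))) \<in> o[at 0 within E](\<lambda>\<epsilon>. \<epsilon> ^ k)"
proof (rule smallo_dominated)
  let ?r = "\<lambda>\<epsilon> x. F \<epsilon> x - (\<Sum>n\<le>k. \<epsilon> ^ n / fact n * c n x)"
  show "(\<lambda>\<epsilon>. Cl_norm l (?r \<epsilon>)) \<in> o[at 0 within E](\<lambda>\<epsilon>. \<epsilon> ^ k)"
    using taylor by (simp add: taylor_at_0_def)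
  have "\<forall>\<^sub>F \<epsilon> in at 0 within E. F \<epsilon> \<in> Cl l"
    using taylor by (simp add: taylor_at_0_def)
  then show "\<forall>\<^sub>F \<epsilon> in at 0 within E.
      \<bar>\<phi> (F \<epsilon>) - (\<Sum>n\<le>k. \<epsilon> ^ n / fact n * \<phi> (c n))\<bar> \<le> \<bar>Cl_norm l (?r \<epsilon>)\<bar>"
  proof eventually_elim
    case (elim \<epsilon>)
    have "?r \<epsilon> \<in> Cl l"
      using taylor by (intro Cl_diff elim taylor_poly_Cl) (simp add: taylor_at_0_def)
    from bound[OF this] show ?case unfolding lin[OF elim] by simp
  qed
qed

text \<open>
  At each point, the difference of the two Taylor polynomials is a scalar polynomial that is
  \<open>o(\<epsilon>^k)\<close>, hence zero.
\<close>

lemma taylor_unique: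
  assumes lim: "0 islimpt E"
    and c: "taylor_at_0 l E k F c" and d: "taylor_at_0 l E k F d" and n: "n \<le> k"
  shows "c n = d n"
proof
  fix x
  show "c n x = d n x"
  proof (cases "x \<in> {0..1}")
    case True
    have eval: "(\<lambda>\<epsilon>. F \<epsilon> x - (\<Sum>n\<le>k. \<epsilon> ^ n / fact n * b n x)) \<in> o[at 0 within E](\<lambda>\<epsilon>. \<epsilon> ^ k)"
      if "taylor_at_0 l E k F b" for b
    proof (rule taylor_functional[OF that])
      show "\<bar>u x\<bar> \<le> Cl_norm l u" if "u \<in> Cl l" for u
        using norm_le_Cl_norm[OF that True] by simp
    qed simp
    have "(\<lambda>\<epsilon>. (F \<epsilon> x - (\<Sum>n\<le>k. \<epsilon> ^ n / fact n * d n x)) - (F \<epsilon> x - (\<Sum>n\<le>k. \<epsilon> ^ n / fact n * c n x)))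
        \<in> o[at 0 within E](\<lambda>\<epsilon>. \<epsilon> ^ k)"
      by (rule sum_in_smallo(2)[OF eval[OF d] eval[OF c]])
    also have "(\<lambda>\<epsilon>. (F \<epsilon> x - (\<Sum>n\<le>k. \<epsilon> ^ n / fact n * d n x)) - (F \<epsilon> x - (\<Sum>n\<le>k. \<epsilon> ^ n / fact n * c n x)))
        = (\<lambda>\<epsilon>. \<Sum>n\<le>k. (c n x - d n x) / fact n * \<epsilon> ^ n)"
      by (simp add: algebra_simps diff_divide_distrib flip: sum_subtractf)
    finally have "(c n x - d n x) / fact n = 0"
      by (rule polynomial_smallo_imp_zero[OF lim _ n])
    then show ?thesis by simp
  next
    case False
    then show ?thesis
      using c d n Cl_outside[OF _ False, of _ l] unfolding taylor_at_0_def by metis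
  qed
qed

text \<open>
  The omitted terms are of order higher than \<open>n\<close>, hence \<open>o(\<epsilon>^n)\<close>. An expansion of order
  \<open>k\<close> therefore determines all derivatives up to order \<open>k\<close>, each of which is defined through
  an expansion of its own order.
\<close>

lemma taylor_truncate:
  assumes taylor: "taylor_at_0 l E k F c" and n: "n \<le> k"
  shows "taylor_at_0 l E n F c"
  unfolding taylor_at_0_def
proof (intro conjI)
  have c: "\<And>m. m \<le> k \<Longrightarrow> c m \<in> Cl l" and F: "\<forall>\<^sub>F \<epsilon> in at 0 within E. F \<epsilon> \<in> Cl l"
    using taylor by (auto simp: taylor_at_0_def)
  show "\<forall>m\<le>n. c m \<in> Cl l" "F 0 = c 0" "\<forall>\<^sub>F \<epsilon> in at 0 within E. F \<epsilon> \<in> Cl l"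
    using taylor n by (auto simp: taylor_at_0_def)
  let ?r = "\<lambda>\<epsilon> x. F \<epsilon> x - (\<Sum>m\<le>k. \<epsilon> ^ m / fact m * c m x)"
  show "(\<lambda>\<epsilon>. Cl_norm l (\<lambda>x. F \<epsilon> x - (\<Sum>m\<le>n. \<epsilon> ^ m / fact m * c m x))) \<in> o[at 0 within E](\<lambda>\<epsilon>. \<epsilon> ^ n)"
  proof (rule smallo_dominated)
    have "(\<lambda>\<epsilon>. Cl_norm l (?r \<epsilon>)) \<in> o[at 0 within E](\<lambda>\<epsilon>. \<epsilon> ^ k)"
      using taylor by (simp add: taylor_at_0_def)
    then have "(\<lambda>\<epsilon>. Cl_norm l (?r \<epsilon>)) \<in> o[at 0 within E](\<lambda>\<epsilon>. \<epsilon> ^ n)"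
      by (rule landau_o.small_big_trans[OF _ power_bigo_power[OF n]])
    moreover have "(\<lambda>\<epsilon>. \<bar>\<epsilon> ^ m / fact m\<bar> * Cl_norm l (c m)) \<in> o[at 0 within E](\<lambda>\<epsilon>. \<epsilon> ^ n)"
      if "m \<in> {n<..k}" for m
    proof -
      have "(\<lambda>\<epsilon>. (1 / fact m * Cl_norm l (c m)) * \<epsilon> ^ m) \<in> o[at 0 within E](\<lambda>\<epsilon>. 1 * \<epsilon> ^ n)"
        using that by (intro landau_o.big_small_mult power_smallo_power) auto
      then have "(\<lambda>\<epsilon>. (1 / fact m * Cl_norm l (c m)) * \<epsilon> ^ m) \<in> o[at 0 within E](\<lambda>\<epsilon>. \<epsilon> ^ n)"
        by simp
      then show ?thesis
        by (rule smallo_dominated[rotated]) (simp add: abs_mult power_abs mult.commute)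
    qed
    ultimately show "(\<lambda>\<epsilon>. Cl_norm l (?r \<epsilon>) + (\<Sum>m\<in>{n<..k}. \<bar>\<epsilon> ^ m / fact m\<bar> * Cl_norm l (c m)))
        \<in> o[at 0 within E](\<lambda>\<epsilon>. \<epsilon> ^ n)"
      by (intro sum_in_smallo big_sum_in_smallo)
    show "\<forall>\<^sub>F \<epsilon> in at 0 within E.
        \<bar>Cl_norm l (\<lambda>x. F \<epsilon> x - (\<Sum>m\<le>n. \<epsilon> ^ m / fact m * c m x))\<bar>
        \<le> \<bar>Cl_norm l (?r \<epsilon>) + (\<Sum>m\<in>{n<..k}. \<bar>\<epsilon> ^ m / fact m\<bar> * Cl_norm l (c m))\<bar>"
      using F
    proof eventually_elim
      case (elim \<epsilon>)
      have r: "?r \<epsilon> \<in> Cl l" by (intro Cl_diff elim taylor_poly_Cl c)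
      have t: "(\<lambda>x. \<epsilon> ^ m / fact m * c m x) \<in> Cl l" if "m \<in> {n<..k}" for m
        using that by (intro Cl_mult_left c) auto
      have split: "(\<Sum>m\<le>k. \<epsilon> ^ m / fact m * c m x)
          = (\<Sum>m\<le>n. \<epsilon> ^ m / fact m * c m x) + (\<Sum>m\<in>{n<..k}. \<epsilon> ^ m / fact m * c m x)" for x
        using n by (subst sum.union_disjoint[symmetric]) (auto intro!: sum.cong)
      have eq: "(\<lambda>x. F \<epsilon> x - (\<Sum>m\<le>n. \<epsilon> ^ m / fact m * c m x))
          = (\<lambda>x. ?r \<epsilon> x + (\<Sum>m\<in>{n<..k}. \<epsilon> ^ m / fact m * c m x))"
        unfolding split by simp
      have "Cl_norm l (\<lambda>x. F \<epsilon> x - (\<Sum>m\<le>n. \<epsilon> ^ m / fact m * c m x))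
          \<le> Cl_norm l (?r \<epsilon>) + (\<Sum>m\<in>{n<..k}. Cl_norm l (\<lambda>x. \<epsilon> ^ m / fact m * c m x))"
        unfolding eq
        by (rule order_trans[OF Cl_norm_add[OF r Cl_sum[OF t]] add_left_mono[OF Cl_norm_sum[OF t]]])
      also have "\<dots> \<le> Cl_norm l (?r \<epsilon>) + (\<Sum>m\<in>{n<..k}. \<bar>\<epsilon> ^ m / fact m\<bar> * Cl_norm l (c m))"
        by (intro add_left_mono sum_mono Cl_norm_mult_left c) auto
      finally have "Cl_norm l (\<lambda>x. F \<epsilon> x - (\<Sum>m\<le>n. \<epsilon> ^ m / fact m * c m x))
          \<le> Cl_norm l (?r \<epsilon>) + (\<Sum>m\<in>{n<..k}. \<bar>\<epsilon> ^ m / fact m\<bar> * Cl_norm l (c m))" .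
      moreover have "0 \<le> Cl_norm l (\<lambda>x. F \<epsilon> x - (\<Sum>m\<le>n. \<epsilon> ^ m / fact m * c m x))"
        using n by (intro Cl_norm_nonneg Cl_diff elim taylor_poly_Cl c) auto
      ultimately show ?case by simp
    qed
  qed
qed

lemma nth_deriv_at_0_eq:
  assumes "0 islimpt E" "taylor_at_0 l E k F c" "n \<le> k"
  shows "nth_deriv_at_0 l E n F = c n"
  unfolding nth_deriv_at_0_def
proof (rule the_equality)
  show "\<exists>b. taylor_at_0 l E n F b \<and> b n = c n"
    using taylor_truncate[OF assms(2,3)] by blast
  fix g assume "\<exists>b. taylor_at_0 l E n F b \<and> b n = g"
  then show "g = c n"
    using taylor_unique[OF assms(1) taylor_truncate[OF assms(2,3)]] by auto
qed

text \<open>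
  Integrating the expansion gives a scalar expansion of a constant. For \<open>\<epsilon> \<mapsto> L_\<epsilon> h_0\<close>,
  whose averages all equal one, this puts \<open>G_i\<close> with \<open>i \<ge> 1\<close> into the space on which
  \<open>I - L_\<epsilon>\<close> is inverted.
\<close>

lemma taylor_coeff_integral_zero:
  assumes lim: "0 islimpt E" and taylor: "taylor_at_0 l E k F c"
    and const: "\<forall>\<^sub>F \<epsilon> in at 0 within E. (\<integral>x. F \<epsilon> x \<partial>leb01) = m"
    and n: "1 \<le> n" "n \<le> k"
  shows "(\<integral>x. c n x \<partial>leb01) = 0"
proof -
  have c: "\<And>n. n \<le> k \<Longrightarrow> c n \<in> Cl l" using taylor by (simp add: taylor_at_0_def)
  define a where "a n = (if n = 0 then m else 0) - (\<integral>x. c n x \<partial>leb01) / fact n" for n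
  have "(\<lambda>\<epsilon>. (\<integral>x. F \<epsilon> x \<partial>leb01) - (\<Sum>n\<le>k. \<epsilon> ^ n / fact n * (\<integral>x. c n x \<partial>leb01)))
      \<in> o[at 0 within E](\<lambda>\<epsilon>. \<epsilon> ^ k)"
  proof (rule taylor_functional[OF taylor])
    show "\<bar>\<integral>x. u x \<partial>leb01\<bar> \<le> Cl_norm l u" if "u \<in> Cl l" for u
      by (rule abs_integral_le_Cl_norm[OF that])
    show "(\<integral>x. F \<epsilon> x - (\<Sum>n\<le>k. \<epsilon> ^ n / fact n * c n x) \<partial>leb01)
        = (\<integral>x. F \<epsilon> x \<partial>leb01) - (\<Sum>n\<le>k. \<epsilon> ^ n / fact n * (\<integral>x. c n x \<partial>leb01))"
      if "F \<epsilon> \<in> Cl l" for \<epsilon>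
    proof -
      have "(\<integral>x. F \<epsilon> x - (\<Sum>n\<le>k. \<epsilon> ^ n / fact n * c n x) \<partial>leb01)
          = (\<integral>x. F \<epsilon> x \<partial>leb01) - (\<integral>x. (\<Sum>n\<le>k. \<epsilon> ^ n / fact n * c n x) \<partial>leb01)"
        by (intro Bochner_Integration.integral_diff Cl_integrable[OF that] Cl_integrable[OF taylor_poly_Cl[OF c]])
      also have "(\<integral>x. (\<Sum>n\<le>k. \<epsilon> ^ n / fact n * c n x) \<partial>leb01)
          = (\<Sum>n\<le>k. (\<integral>x. \<epsilon> ^ n / fact n * c n x \<partial>leb01))"
        by (intro Bochner_Integration.integral_sum Cl_integrable[OF Cl_mult_left[OF c]]) auto
      finally show ?thesis by simp
    qed
  qed
  then have "(\<lambda>\<epsilon>. m - (\<Sum>n\<le>k. \<epsilon> ^ n / fact n * (\<integral>x. c n x \<partial>leb01))) \<in> o[at 0 within E](\<lambda>\<epsilon>. \<epsilon> ^ k)"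
    by (rule smallo_dominated[rotated]) (use const in \<open>auto elim!: eventually_mono\<close>)
  also have "(\<lambda>\<epsilon>. m - (\<Sum>n\<le>k. \<epsilon> ^ n / fact n * (\<integral>x. c n x \<partial>leb01))) = (\<lambda>\<epsilon>. \<Sum>n\<le>k. a n * \<epsilon> ^ n)"
  proof
    fix \<epsilon> :: real
    have "m = (\<Sum>n\<in>{0}. (if n = 0 then m else 0) * \<epsilon> ^ n)" by simp
    also have "\<dots> = (\<Sum>n\<le>k. (if n = 0 then m else 0) * \<epsilon> ^ n)"
      by (rule sum.mono_neutral_left) auto
    finally show "m - (\<Sum>n\<le>k. \<epsilon> ^ n / fact n * (\<integral>x. c n x \<partial>leb01)) = (\<Sum>n\<le>k. a n * \<epsilon> ^ n)"
      by (simp add: a_def left_diff_distrib right_diff_distrib sum_subtractf mult.commute)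
  qed
  finally have "a n = 0" by (rule polynomial_smallo_imp_zero[OF lim _ n(2)])
  then show ?thesis using n(1) by (simp add: a_def)
qed

section \<open>Inverting $I - L$ on functions of average zero\<close>

lemma Cl0D: "u \<in> Cl0 l \<Longrightarrow> u \<in> Cl l" "u \<in> Cl0 l \<Longrightarrow> (\<integral>x. u x \<partial>leb01) = 0"
  by (auto simp: Cl0_def)

lemma Cl0_zero: "(\<lambda>_. 0) \<in> Cl0 l"
  by (simp add: Cl0_def Cl_zero)

lemma Cl0_add: "u \<in> Cl0 l \<Longrightarrow> v \<in> Cl0 l \<Longrightarrow> (\<lambda>x. u x + v x) \<in> Cl0 l"
  by (auto simp: Cl0_def Cl_add Bochner_Integration.integral_add[OF Cl_integrable Cl_integrable])

lemma Cl_integral_diff: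
  fixes u v :: "real \<Rightarrow> real"
  assumes "u \<in> Cl l" "v \<in> Cl l"
  shows "(\<integral>x. u x - v x \<partial>leb01) = (\<integral>x. u x \<partial>leb01) - (\<integral>x. v x \<partial>leb01)"
  by (intro Bochner_Integration.integral_diff Cl_integrable[OF assms(1)] Cl_integrable[OF assms(2)])

lemma Cl0_diff: "u \<in> Cl0 l \<Longrightarrow> v \<in> Cl0 l \<Longrightarrow> (\<lambda>x. u x - v x) \<in> Cl0 l"
  by (simp add: Cl0_def Cl_diff Cl_integral_diff[of _ l])

lemma Cl0_mult_left: "u \<in> Cl0 l \<Longrightarrow> (\<lambda>x. c * u x) \<in> Cl0 l"
  by (simp add: Cl0_def Cl_mult_left)

lemma Cl0_sum: "(\<And>i. i \<in> S \<Longrightarrow> f i \<in> Cl0 l) \<Longrightarrow> (\<lambda>x. \<Sum>i\<in>S. f i x) \<in> Cl0 l"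
  by (induction S rule: infinite_finite_induct) (auto intro: Cl0_add Cl0_zero)

lemma Cl_norm_zeroD:
  assumes "f \<in> Cl l" "Cl_norm l f = 0" shows "f = (\<lambda>_. 0)"
proof
  show "f x = 0" for x using norm_le_Cl_norm_everywhere[OF assms(1), of x] assms(2) by simp
qed

lemma Cl_norm_minus_commute:
  fixes f g :: "real \<Rightarrow> real"
  assumes "f \<in> Cl l" "g \<in> Cl l"
  shows "Cl_norm l (\<lambda>x. f x - g x) = Cl_norm l (\<lambda>x. g x - f x)"
  using Cl_norm_mult_left[OF Cl_diff[OF assms], of "-1"]
    Cl_norm_mult_left[OF Cl_diff[OF assms(2,1)], of "-1"] by simp

text \<open>
  A point of the boundary of the spectrum is an approximate eigenvalue. Here the bound from
  below excludes that \<open>1\<close> is an approximate eigenvalue on zero averages, and \<open>1\<close> is a limit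
  of points \<open>z > 1\<close> of the resolvent set, so that \<open>1\<close> itself must belong to the resolvent
  set.

  In detail, for \<open>z = 1 + s\<close> close to \<open>1\<close> the bound from below persists with twice the
  constant, and \<open>u - \<Lambda> u = g\<close> is equivalent to \<open>z u - \<Lambda> u = g + s u\<close>. Solving the left
  side for \<open>u\<close> turns this into a fixed-point equation for a contraction.
\<close>

lemma I_minus_surjective_of_bounded_below:
  fixes \<Lambda> :: "(real \<Rightarrow> real) \<Rightarrow> real \<Rightarrow> real"
  assumes \<Lambda>_Cl: "\<And>u. u \<in> Cl l \<Longrightarrow> \<Lambda> u \<in> Cl l"
    and \<Lambda>_diff: "\<And>u v. u \<in> Cl l \<Longrightarrow> v \<in> Cl l \<Longrightarrow> \<Lambda> (\<lambda>x. u x - v x) = (\<lambda>x. \<Lambda> u x - \<Lambda> v x)"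
    and bounded: "\<And>u. u \<in> Cl l \<Longrightarrow> Cl_norm l (\<Lambda> u) \<le> C * Cl_norm l u"
    and below: "\<And>u. u \<in> Cl0 l \<Longrightarrow> Cl_norm l u \<le> K * Cl_norm l (\<lambda>x. u x - \<Lambda> u x)"
    and resolvent: "\<And>z g. 1 < z \<Longrightarrow> g \<in> Cl0 l \<Longrightarrow> \<exists>u\<in>Cl0 l. (\<lambda>x. z * u x - \<Lambda> u x) = g"
    and g: "g \<in> Cl0 l"
  shows "\<exists>u\<in>Cl0 l. (\<lambda>x. u x - \<Lambda> u x) = g"
proof -
  define K' where "K' = max K 1"
  \<comment> \<open>With this \<open>s\<close> the bound from below at \<open>1 + s\<close> has constant \<open>2 K'\<close>, so the iteration contracts by \<open>2 K' s = 1/2\<close>.\<close>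
  define s where "s = 1 / (4 * K')"
  have K': "1 \<le> K'" and s: "0 < s" and K's: "K' * s = 1 / 4" by (auto simp: K'_def s_def)
  have below': "Cl_norm l u \<le> K' * Cl_norm l (\<lambda>x. u x - \<Lambda> u x)" if "u \<in> Cl0 l" for u
  proof -
    have "0 \<le> Cl_norm l (\<lambda>x. u x - \<Lambda> u x)"
      using Cl0D(1)[OF that] by (intro Cl_norm_nonneg Cl_diff \<Lambda>_Cl)
    then have "K * Cl_norm l (\<lambda>x. u x - \<Lambda> u x) \<le> K' * Cl_norm l (\<lambda>x. u x - \<Lambda> u x)"
      by (intro mult_right_mono) (simp add: K'_def)
    then show ?thesis using below[OF that] by simp
  qed
  have below_z: "Cl_norm l u \<le> 2 * K' * Cl_norm l (\<lambda>x. (1 + s) * u x - \<Lambda> u x)" if u0: "u \<in> Cl0 l" for u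
  proof -
    note u = Cl0D(1)[OF u0]
    have "Cl_norm l (\<lambda>x. u x - \<Lambda> u x) = Cl_norm l (\<lambda>x. ((1 + s) * u x - \<Lambda> u x) - s * u x)"
      by (simp add: algebra_simps)
    also have "\<dots> \<le> Cl_norm l (\<lambda>x. (1 + s) * u x - \<Lambda> u x) + Cl_norm l (\<lambda>x. s * u x)"
      by (intro Cl_norm_diff Cl_diff Cl_mult_left u \<Lambda>_Cl)
    also have "\<dots> \<le> Cl_norm l (\<lambda>x. (1 + s) * u x - \<Lambda> u x) + s * Cl_norm l u"
      using Cl_norm_mult_left[OF u, of s] s by simp
    finally have "K' * Cl_norm l (\<lambda>x. u x - \<Lambda> u x)
        \<le> K' * (Cl_norm l (\<lambda>x. (1 + s) * u x - \<Lambda> u x) + s * Cl_norm l u)"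
      using K' by (intro mult_left_mono) auto
    also have "\<dots> = K' * Cl_norm l (\<lambda>x. (1 + s) * u x - \<Lambda> u x) + Cl_norm l u / 4"
      using K's by (simp add: distrib_left flip: mult.assoc)
    finally show ?thesis using below'[OF u0] Cl_norm_nonneg[OF u] by simp
  qed
  obtain S where S: "\<And>g. g \<in> Cl0 l \<Longrightarrow> S g \<in> Cl0 l"
    "\<And>g. g \<in> Cl0 l \<Longrightarrow> (\<lambda>x. (1 + s) * S g x - \<Lambda> (S g) x) = g"
    using resolvent[of "1 + s"] s by (metis less_add_same_cancel1)
  define v where "v = rec_nat (\<lambda>_. 0) (\<lambda>_ w. S (\<lambda>x. g x + s * w x))"
  have v_Suc: "v (Suc n) = S (\<lambda>x. g x + s * v n x)" for n by (simp add: v_def)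
  have v0: "v n \<in> Cl0 l" for n
  proof (induction n)
    case 0
    show ?case by (simp add: v_def Cl0_zero)
  next
    case (Suc n)
    show ?case unfolding v_Suc by (intro S Cl0_add g Cl0_mult_left Suc)
  qed
  note v = Cl0D(1)[OF v0]
  have v_eq: "(1 + s) * v (Suc n) x - \<Lambda> (v (Suc n)) x = g x + s * v n x" for n x
    using S(2)[OF Cl0_add[OF g Cl0_mult_left[OF v0]], of s n] unfolding v_Suc by (rule fun_cong)
  define D where "D = Cl_norm l (\<lambda>x. v 1 x - v 0 x)"
  have step: "Cl_norm l (\<lambda>x. v (Suc n) x - v n x) \<le> D / 2 ^ n" for n
  proof (induction n)
    case 0
    show ?case by (simp add: D_def)
  next
    case (Suc n)
    let ?d = "\<lambda>n x. v (Suc n) x - v n x"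
    have "(\<lambda>x. (1 + s) * ?d (Suc n) x - \<Lambda> (?d (Suc n)) x) = (\<lambda>x. s * ?d n x)"
      unfolding \<Lambda>_diff[OF v v] using v_eq[of "Suc n"] v_eq[of n] by (auto simp: fun_eq_iff algebra_simps)
    then have "Cl_norm l (?d (Suc n)) \<le> 2 * K' * Cl_norm l (\<lambda>x. s * ?d n x)"
      using below_z[OF Cl0_diff[OF v0 v0], of "Suc (Suc n)" "Suc n"] by simp
    also have "\<dots> \<le> 2 * K' * (s * Cl_norm l (?d n))"
      using Cl_norm_mult_left[OF Cl_diff[OF v v], of s "Suc n" n] K' s by (intro mult_left_mono) auto
    also have "\<dots> = 2 * (K' * s) * Cl_norm l (?d n)" by (simp add: mult.assoc)
    also have "\<dots> = Cl_norm l (?d n) / 2" unfolding K's by simp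
    also have "\<dots> \<le> D / 2 ^ Suc n" using Suc by simp
    finally show ?case .
  qed
  have D: "0 \<le> D" unfolding D_def by (intro Cl_norm_nonneg Cl_diff v)
  have tele: "Cl_norm l (\<lambda>x. v (n + j) x - v n x) \<le> 2 * D / 2 ^ n - 2 * D / 2 ^ (n + j)" for n j
  proof (induction j)
    case 0
    show ?case using Cl_norm_mult_left[OF Cl_zero, of l 0] by simp
  next
    case (Suc j)
    have "Cl_norm l (\<lambda>x. v (n + Suc j) x - v n x)
        = Cl_norm l (\<lambda>x. (v (Suc (n + j)) x - v (n + j) x) + (v (n + j) x - v n x))" by simp
    also have "\<dots> \<le> Cl_norm l (\<lambda>x. v (Suc (n + j)) x - v (n + j) x) + Cl_norm l (\<lambda>x. v (n + j) x - v n x)"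
      by (intro Cl_norm_add Cl_diff v)
    also have "\<dots> \<le> D / 2 ^ (n + j) + (2 * D / 2 ^ n - 2 * D / 2 ^ (n + j))"
      by (intro add_mono step Suc)
    also have "\<dots> = 2 * D / 2 ^ n - 2 * D / 2 ^ (n + Suc j)" by simp
    finally show ?case .
  qed
  have dist: "Cl_norm l (\<lambda>x. v m x - v n x) \<le> 2 * D / 2 ^ N" if mn: "N \<le> m" "N \<le> n" for m n N
  proof -
    have *: "Cl_norm l (\<lambda>x. v m x - v n x) \<le> 2 * D / 2 ^ N" if "N \<le> n" "n \<le> m" for m n
    proof -
      have "Cl_norm l (\<lambda>x. v m x - v n x) \<le> 2 * D / 2 ^ n - 2 * D / 2 ^ m"
        using tele[of n "m - n"] that by simp
      also have "\<dots> \<le> 2 * D / 2 ^ n" using D by simp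
      also have "\<dots> \<le> 2 * D / 2 ^ N"
        using that D by (intro divide_left_mono power_increasing) auto
      finally show ?thesis .
    qed
    show ?thesis
      using *[of n m] *[of m n] mn Cl_norm_minus_commute[OF v v, of m n] by (cases "n \<le> m") auto
  qed
  obtain u where u: "u \<in> Cl l" "(\<lambda>n. Cl_norm l (\<lambda>x. v n x - u x)) \<longlonglongrightarrow> 0"
  proof (rule Cl_complete[of v l])
    fix e :: real assume e: "e > 0"
    have "(\<lambda>N. 2 * D * (1 / 2) ^ N) \<longlonglongrightarrow> 2 * D * 0"
      by (intro tendsto_mult_left LIMSEQ_power_zero) simp
    then have "\<forall>\<^sub>F N in sequentially. 2 * D * (1 / 2) ^ N < e"
      using e by (intro order_tendstoD(2)) auto
    then obtain N where N: "2 * D / 2 ^ N < e"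
      by (auto simp: eventually_sequentially power_one_over)
    have "Cl_norm l (\<lambda>x. v m x - v n x) < e" if "N \<le> m" "N \<le> n" for m n
      using dist[OF that] N by simp
    then show "\<exists>N. \<forall>m\<ge>N. \<forall>n\<ge>N. Cl_norm l (\<lambda>x. v m x - v n x) < e" by blast
  qed (use v in auto)
  have "(\<lambda>n. \<bar>\<integral>x. u x \<partial>leb01\<bar>) \<longlonglongrightarrow> 0"
  proof (rule tendsto_sandwich[OF _ _ tendsto_const u(2)])
    have "\<bar>\<integral>x. u x \<partial>leb01\<bar> \<le> Cl_norm l (\<lambda>x. v n x - u x)" for n
    proof -
      have "(\<integral>x. v n x - u x \<partial>leb01) = - (\<integral>x. u x \<partial>leb01)"
        using Cl0D(2)[OF v0] by (simp add: Cl_integral_diff[OF v u(1)])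
      then show ?thesis using abs_integral_le_Cl_norm[OF Cl_diff[OF v u(1)], of n] by simp
    qed
    then show "\<forall>\<^sub>F n in sequentially. \<bar>\<integral>x. u x \<partial>leb01\<bar> \<le> Cl_norm l (\<lambda>x. v n x - u x)" by simp
  qed simp
  then have u0: "u \<in> Cl0 l"
    using u(1) LIMSEQ_unique[OF _ tendsto_const] by (fastforce simp: Cl0_def)
  let ?w = "\<lambda>x. (u x - \<Lambda> u x) - g x"
  have w: "?w \<in> Cl l" by (intro Cl_diff \<Lambda>_Cl u Cl0D(1)[OF g])
  let ?e = "\<lambda>n. Cl_norm l (\<lambda>x. v n x - u x)"
  have bound_w: "Cl_norm l ?w \<le> (1 + C) * ?e (Suc n) + s * (D / 2 ^ n)" for n
  proof -
    let ?d = "\<lambda>x. v (Suc n) x - u x"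
    have d: "?d \<in> Cl l" by (intro Cl_diff v u)
    have "?w = (\<lambda>x. (\<Lambda> ?d x - ?d x) - s * (v (Suc n) x - v n x))"
      unfolding \<Lambda>_diff[OF v u(1)] using v_eq[of n] by (auto simp: fun_eq_iff algebra_simps)
    then have "Cl_norm l ?w \<le> Cl_norm l (\<lambda>x. \<Lambda> ?d x - ?d x) + Cl_norm l (\<lambda>x. s * (v (Suc n) x - v n x))"
      using Cl_norm_diff[OF Cl_diff[OF \<Lambda>_Cl[OF d] d] Cl_mult_left[OF Cl_diff[OF v v]]] by simp
    also have "\<dots> \<le> (Cl_norm l (\<Lambda> ?d) + Cl_norm l ?d) + s * Cl_norm l (\<lambda>x. v (Suc n) x - v n x)"
      using Cl_norm_diff[OF \<Lambda>_Cl[OF d] d] Cl_norm_mult_left[OF Cl_diff[OF v v], of s "Suc n" n] s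
      by (intro add_mono) auto
    also have "\<dots> \<le> (C * Cl_norm l ?d + Cl_norm l ?d) + s * (D / 2 ^ n)"
      using s by (intro add_mono mult_left_mono step bounded d) auto
    finally show ?thesis by (simp add: algebra_simps)
  qed
  have "(\<lambda>n. (1 + C) * ?e (Suc n) + s * (D * (1 / 2) ^ n)) \<longlonglongrightarrow> (1 + C) * 0 + s * (D * 0)"
    by (intro tendsto_add tendsto_mult_left LIMSEQ_power_zero LIMSEQ_Suc[OF u(2)]) simp
  then have "Cl_norm l ?w \<le> (1 + C) * 0 + s * (D * 0)"
    by (rule LIMSEQ_le_const) (use bound_w in \<open>auto simp: power_one_over\<close>)
  then have "?w = (\<lambda>_. 0)"
    using Cl_norm_zeroD[OF w] Cl_norm_nonneg[OF w] by simp
  then show ?thesis using u0 by (auto simp: fun_eq_iff)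
qed

context random_maps
begin

lemma annealed_sum:
  assumes "\<epsilon> \<in> E" "\<And>i. i \<in> S \<Longrightarrow> f i \<in> (Cl l :: (real \<Rightarrow> real) set)"
  shows "L \<epsilon> (\<lambda>x. \<Sum>i\<in>S. f i x) = (\<lambda>x. \<Sum>i\<in>S. L \<epsilon> (f i) x)"
  using assms(2)
proof (induction S rule: infinite_finite_induct)
  case (insert a S)
  then show ?case
    using annealed_add[OF assms(1), of "f a" "\<lambda>x. \<Sum>i\<in>S. f i x"] Cl_sum[of S f l] by simp
qed (use annealed_mult_left[of \<epsilon> 0 "\<lambda>_. 0"] in simp_all)

lemma annealed_Cl0: "\<epsilon> \<in> E \<Longrightarrow> u \<in> Cl0 l \<Longrightarrow> L \<epsilon> u \<in> Cl0 l"
  by (simp add: Cl0_def annealed_Cl annealed_integral)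

lemma I_minus_Cl0: "\<epsilon> \<in> E \<Longrightarrow> u \<in> Cl0 l \<Longrightarrow> (\<lambda>x. u x - L \<epsilon> u x) \<in> Cl0 l"
  by (intro Cl0_diff annealed_Cl0)

text \<open>
  Differences of two preimages are fixed functions of average zero. The space of fixed
  functions is spanned by \<open>h\<close>, whose average is one, so such a difference vanishes.
\<close>

lemma simple_eigenvalue_imp_inj:
  fixes h :: "real \<Rightarrow> real"
  assumes \<epsilon>: "\<epsilon> \<in> E" and h: "h \<in> Cl l" "L \<epsilon> h = h" "(\<integral>x. h x \<partial>leb01) = 1"
    and simple: "Cl_simple_eigenvalue l (L \<epsilon>) 1"
  shows "inj_on (\<lambda>u x. u x - L \<epsilon> u x) (Cl0 l)"
proof (rule inj_onI)
  obtain f where f: "{g \<in> Cl l. \<exists>n. ((\<lambda>u x. L \<epsilon> u x - 1 * u x) ^^ n) g = (\<lambda>_. 0)}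
      = range (\<lambda>c x. c * (f x :: complex))"
    using simple unfolding Cl_simple_eigenvalue_def by blast
  have span: "\<exists>c. \<forall>x. complex_of_real (u x) = c * f x" if u: "u \<in> Cl l" "L \<epsilon> u = u" for u
  proof -
    let ?u = "\<lambda>x. complex_of_real (u x)"
    have "?u \<in> Cl l" by (rule Cl_bounded_linear[OF u(1) bounded_linear_of_real])
    moreover have "((\<lambda>u x. L \<epsilon> u x - 1 * u x) ^^ 1) ?u = (\<lambda>_. 0)"
      by (simp add: annealed_of_real[OF \<epsilon> u(1)] u(2))
    ultimately have "?u \<in> range (\<lambda>c x. c * f x)" unfolding f[symmetric] by blast
    then show ?thesis by (auto simp: fun_eq_iff)
  qed
  obtain d where d: "\<And>x. complex_of_real (h x) = d * f x" using span[OF h(1,2)] by blast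
  have "d \<noteq> 0"
  proof
    assume "d = 0"
    then have "h = (\<lambda>_. 0)" using d by (auto simp: fun_eq_iff)
    then show False using h(3) by simp
  qed
  fix u v assume u: "u \<in> Cl0 l" and v: "v \<in> Cl0 l" and eq: "(\<lambda>x. u x - L \<epsilon> u x) = (\<lambda>x. v x - L \<epsilon> v x)"
  let ?w = "\<lambda>x. u x - v x"
  have w: "?w \<in> Cl0 l" by (rule Cl0_diff[OF u v])
  have "L \<epsilon> ?w = ?w"
    using eq unfolding annealed_diff[OF \<epsilon> Cl0D(1)[OF u] Cl0D(1)[OF v]] by (auto simp: fun_eq_iff algebra_simps)
  then obtain c where c: "\<And>x. complex_of_real (?w x) = c * f x" using span[OF Cl0D(1)[OF w]] by blast
  have w_eq: "?w = (\<lambda>x. Re (c / d) * h x)"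
  proof
    fix x
    have "complex_of_real (?w x) = (c / d) * complex_of_real (h x)"
      unfolding c d using \<open>d \<noteq> 0\<close> by simp
    then have "Re (complex_of_real (?w x)) = Re ((c / d) * complex_of_real (h x))" by (rule arg_cong)
    then show "?w x = Re (c / d) * h x" by (simp del: times_divide_eq_left)
  qed
  have "(\<integral>x. ?w x \<partial>leb01) = Re (c / d)"
    unfolding w_eq using h(3) by simp
  then have "Re (c / d) = 0" using Cl0D(2)[OF w] by simp
  then show "u = v" using w_eq by (simp add: fun_eq_iff)
qed

text \<open>
  The real part of the complex solution solves the real equation. Since \<open>L\<close> preserves
  averages, integrating the equation gives \<open>(z - 1) \<integral>u = \<integral>g = 0\<close>.
\<close>

lemma resolvent_Cl0:
  assumes \<epsilon>: "\<epsilon> \<in> E" and z: "1 < z" "complex_of_real z \<notin> Cl_spectrum l (L \<epsilon>)" and g: "g \<in> Cl0 l"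
  shows "\<exists>u\<in>Cl0 l. (\<lambda>x. z * u x - L \<epsilon> u x) = g"
proof -
  have "bij_betw (\<lambda>f x. complex_of_real z * f x - L \<epsilon> f x) (Cl l) (Cl l)"
    using z(2) by (simp add: Cl_spectrum_def)
  moreover have "(\<lambda>x. complex_of_real (g x)) \<in> Cl l"
    by (rule Cl_bounded_linear[OF Cl0D(1)[OF g] bounded_linear_of_real])
  ultimately obtain w where w: "w \<in> Cl l"
    and w_eq: "(\<lambda>x. complex_of_real z * w x - L \<epsilon> w x) = (\<lambda>x. complex_of_real (g x))"
    unfolding bij_betw_def by (metis (no_types, lifting) imageE)
  let ?u = "\<lambda>x. Re (w x)"
  have u: "?u \<in> Cl l" by (rule Cl_bounded_linear[OF w bounded_linear_Re])
  have eq: "z * ?u x - L \<epsilon> ?u x = g x" for x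
  proof -
    have "Re (complex_of_real z * w x - L \<epsilon> w x) = Re (complex_of_real (g x))"
      using w_eq by metis
    then show ?thesis by (simp add: annealed_complex_bounded_linear[OF \<epsilon> w bounded_linear_Re])
  qed
  have "(\<integral>x. z * ?u x - L \<epsilon> ?u x \<partial>leb01) = z * (\<integral>x. ?u x \<partial>leb01) - (\<integral>x. ?u x \<partial>leb01)"
    using Cl_integrable[OF u] Cl_integrable[OF annealed_Cl[OF \<epsilon> u]] annealed_integral[OF \<epsilon> u]
    by (simp add: Bochner_Integration.integral_diff)
  then have "(z - 1) * (\<integral>x. ?u x \<partial>leb01) = 0"
    unfolding eq using Cl0D(2)[OF g] by (simp add: algebra_simps)
  then have "?u \<in> Cl0 l" using u z(1) by (simp add: Cl0_def)
  then show ?thesis using eq by (intro bexI[of _ ?u]) auto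
qed

text \<open>
  The location of the spectrum and the simplicity of the eigenvalue \<open>1\<close> do not by themselves
  make \<open>I - L\<close> surjective on zero averages: the part of \<open>L - I\<close> that belongs to the point
  \<open>1\<close> of the spectrum could be quasinilpotent on an infinite-dimensional space. The norm bound
  for the inverse supplies what is missing. On the range of \<open>I - L\<close>, injectivity makes the chosen
  inverse a genuine one, and there the norm bound says that \<open>I - L\<close> is bounded from below.
\<close>

lemma I_minus_bij:
  fixes h :: "real \<Rightarrow> real"
  assumes \<epsilon>: "\<epsilon> \<in> E" and h: "h \<in> Cl l" "L \<epsilon> h = h" "(\<integral>x. h x \<partial>leb01) = 1"
    and simple: "Cl_simple_eigenvalue l (L \<epsilon>) 1"
    and spectrum: "Cl_spectrum l (L \<epsilon>) - {1} \<subseteq> ball 0 \<delta>" "\<delta> < 1"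
    and bounded: "\<And>g. g \<in> Cl0 l \<Longrightarrow> Cl_norm l (inv_I_minus l (L \<epsilon>) g) \<le> K * Cl_norm l g"
  shows "bij_betw (\<lambda>u x. u x - L \<epsilon> u x) (Cl0 l) (Cl0 l)"
  unfolding bij_betw_def
proof (intro conjI equalityI subsetI)
  show inj: "inj_on (\<lambda>u x. u x - L \<epsilon> u x) (Cl0 l)"
    by (rule simple_eigenvalue_imp_inj[OF \<epsilon> h simple])
  show "g \<in> Cl0 l" if "g \<in> (\<lambda>u x. u x - L \<epsilon> u x) ` Cl0 l" for g
    using that I_minus_Cl0[OF \<epsilon>] by blast
  fix g :: "real \<Rightarrow> real" assume g: "g \<in> Cl0 l"
  obtain C where C: "\<forall>\<Phi> \<in> (Cl l :: (real \<Rightarrow> real) set). Cl_norm l (L \<epsilon> \<Phi>) \<le> C * Cl_norm l \<Phi>"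
    using annealed_bounded[OF \<epsilon>] by blast
  have "\<exists>u\<in>Cl0 l. (\<lambda>x. u x - L \<epsilon> u x) = g"
  proof (rule I_minus_surjective_of_bounded_below[OF _ _ _ _ _ g])
    show "Cl_norm l u \<le> K * Cl_norm l (\<lambda>x. u x - L \<epsilon> u x)" if "u \<in> Cl0 l" for u
      using bounded[OF I_minus_Cl0[OF \<epsilon> that]] inv_into_f_f[OF inj that] by (simp add: inv_I_minus_def)
    show "\<exists>u\<in>Cl0 l. (\<lambda>x. z * u x - L \<epsilon> u x) = g" if z: "1 < z" and "g \<in> Cl0 l" for z g
    proof (rule resolvent_Cl0[OF \<epsilon> z _ that(2)])
      have "complex_of_real z \<notin> ball 0 \<delta>" "complex_of_real z \<noteq> 1" using z spectrum(2) by auto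
      then show "complex_of_real z \<notin> Cl_spectrum l (L \<epsilon>)" using spectrum(1) by blast
    qed
  qed (use C annealed_Cl[OF \<epsilon>] annealed_diff[OF \<epsilon>] in auto)
  then show "g \<in> (\<lambda>u x. u x - L \<epsilon> u x) ` Cl0 l" by blast
qed

end

section \<open>Expansion of the invariant density\<close>

text \<open>
  Collecting the powers \<open>\<epsilon>^(i + j)\<close> in the product expansion produces the binomial
  coefficients, because \<open>1 / (i! j!)\<close> is \<open>(i + j choose i) / (i + j)!\<close>.
\<close>

lemma sum_triangle_binomial:
  fixes b :: "nat \<Rightarrow> nat \<Rightarrow> real"
  shows "(\<Sum>i=1..k. \<epsilon> ^ i / fact i * (\<Sum>j\<le>k - i. \<epsilon> ^ j / fact j * b i j))
    = (\<Sum>n=1..k. \<epsilon> ^ n / fact n * (\<Sum>i=1..n. real (n choose i) * b i (n - i)))"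
proof -
  have "(\<Sum>i=1..k. \<epsilon> ^ i / fact i * (\<Sum>j\<le>k - i. \<epsilon> ^ j / fact j * b i j))
      = (\<Sum>(i, j)\<in>(SIGMA i:{1..k}. {..k - i}). \<epsilon> ^ i / fact i * (\<epsilon> ^ j / fact j * b i j))"
    unfolding sum_distrib_left by (rule sum.Sigma) auto
  also have "\<dots> = (\<Sum>(n, i)\<in>(SIGMA n:{1..k}. {1..n}). \<epsilon> ^ n / fact n * (real (n choose i) * b i (n - i)))"
  proof (rule sum.reindex_bij_witness[where i = "\<lambda>(n, i). (i, n - i)" and j = "\<lambda>(i, j). (i + j, i)"])
    fix p assume "p \<in> (SIGMA i:{1..k}. {..k - i})"
    then show "(case case p of (i, j) \<Rightarrow> (i + j, i) of
          (n, i) \<Rightarrow> \<epsilon> ^ n / fact n * (real (n choose i) * b i (n - i)))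
        = (case p of (i, j) \<Rightarrow> \<epsilon> ^ i / fact i * (\<epsilon> ^ j / fact j * b i j))"
      by (auto simp: binomial_fact power_add)
  qed auto
  also have "\<dots> = (\<Sum>n=1..k. \<epsilon> ^ n / fact n * (\<Sum>i=1..n. real (n choose i) * b i (n - i)))"
    unfolding sum_distrib_left by (rule sum.Sigma[symmetric]) auto
  finally show ?thesis .
qed

lemma sum_atMost_eq_sum_from_1: "(\<Sum>n\<le>k. f n) = f 0 + (\<Sum>n=1..k::nat. f n :: 'b::comm_monoid_add)"
  using sum.atLeast_Suc_atMost[of 0 k f] by (simp add: atMost_atLeast0)

context random_maps
begin

text \<open>
  The function \<open>h_\<epsilon> - h_0\<close> is the preimage under \<open>I - L_\<epsilon>\<close> of \<open>L_\<epsilon> h_0 - h_0\<close>. Inverting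
  the Taylor polynomial of the latter term by term leaves two kinds of remainders: the inverse
  applied to the remainder of \<open>L_\<epsilon> h_0\<close>, controlled by the uniform bound of the inverse, and
  \<open>\<epsilon>^i\<close> times the remainder of order \<open>k - i\<close> of the curve \<open>(I - L_\<epsilon>)^(-1) G_i\<close>.
\<close>

lemma density_taylor:
  fixes h :: "real \<Rightarrow> real \<Rightarrow> real"
  assumes h: "\<And>\<epsilon>. \<epsilon> \<in> E \<Longrightarrow> h \<epsilon> \<in> Cl l" "\<And>\<epsilon>. \<epsilon> \<in> E \<Longrightarrow> L \<epsilon> (h \<epsilon>) = h \<epsilon>"
      "\<And>\<epsilon>. \<epsilon> \<in> E \<Longrightarrow> (\<integral>x. h \<epsilon> x \<partial>leb01) = 1"
    and bij: "\<And>\<epsilon>. \<epsilon> \<in> E \<Longrightarrow> \<bar>\<epsilon>\<bar> < r \<Longrightarrow> bij_betw (\<lambda>u x. u x - L \<epsilon> u x) (Cl0 l) (Cl0 l)"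
    and bounded: "\<And>\<epsilon> g. \<epsilon> \<in> E \<Longrightarrow> \<bar>\<epsilon>\<bar> < r \<Longrightarrow> g \<in> Cl0 l \<Longrightarrow>
      Cl_norm l (inv_I_minus l (L \<epsilon>) g) \<le> K * Cl_norm l g"
    and r: "0 < r"
    and G: "taylor_at_0 l E k (\<lambda>\<epsilon>. L \<epsilon> (h 0)) G"
    and b: "\<And>i. 1 \<le> i \<Longrightarrow> i \<le> k \<Longrightarrow>
      taylor_at_0 l E (k - i) (\<lambda>\<epsilon>. inv_I_minus l (L \<epsilon>) (G i)) (b i)"
  shows "taylor_at_0 l E k h
    (\<lambda>n. if n = 0 then h 0 else (\<lambda>x. \<Sum>i=1..n. real (n choose i) * b i (n - i) x))"
proof -
  let ?inv = "\<lambda>\<epsilon>. inv_I_minus l (L \<epsilon>)"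
  let ?d = "\<lambda>n. if n = 0 then h 0 else (\<lambda>x. \<Sum>i=1..n. real (n choose i) * b i (n - i) x)"
  let ?near = "\<lambda>\<epsilon>. \<epsilon> \<in> E \<and> \<bar>\<epsilon>\<bar> < r"
  have near: "\<forall>\<^sub>F \<epsilon> in at 0 within E. ?near \<epsilon>"
    unfolding eventually_at using r by (intro exI[of _ r]) auto
  have G_Cl: "\<And>n. n \<le> k \<Longrightarrow> G n \<in> Cl l" and G_0: "G 0 = h 0"
    using G h(2)[OF zero_param(1)] by (auto simp: taylor_at_0_def)
  have G_Cl0: "G n \<in> Cl0 l" if "1 \<le> n" "n \<le> k" for n
  proof -
    have "\<forall>\<^sub>F \<epsilon> in at 0 within E. (\<integral>x. L \<epsilon> (h 0) x \<partial>leb01) = 1"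
      using near by eventually_elim
        (use annealed_integral[OF _ h(1)[OF zero_param(1)]] h(3)[OF zero_param(1)] in auto)
    then have "(\<integral>x. G n x \<partial>leb01) = 0"
      by (rule taylor_coeff_integral_zero[OF zero_param(2) G _ that])
    then show ?thesis using G_Cl[OF that(2)] by (simp add: Cl0_def)
  qed
  have b_Cl: "b i j \<in> Cl l" if "1 \<le> i" "i + j \<le> k" for i j
    using b[of i] that by (simp add: taylor_at_0_def)
  \<comment> \<open>The remainders of the expansions of \<open>L \<epsilon> (h 0)\<close> and of the preimages of \<open>G i\<close>.\<close>
  define \<rho>0 where "\<rho>0 \<epsilon> x = L \<epsilon> (h 0) x - (\<Sum>n\<le>k. \<epsilon> ^ n / fact n * G n x)" for \<epsilon> x
  define \<rho> where "\<rho> i \<epsilon> x = ?inv \<epsilon> (G i) x - (\<Sum>j\<le>k - i. \<epsilon> ^ j / fact j * b i j x)" for i \<epsilon> x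
  have inv: "?inv \<epsilon> g \<in> Cl0 l" "(\<lambda>x. ?inv \<epsilon> g x - L \<epsilon> (?inv \<epsilon> g) x) = g"
    if "?near \<epsilon>" "g \<in> Cl0 l" for \<epsilon> g
    using bij[of \<epsilon>] that unfolding inv_I_minus_def bij_betw_def
    by (simp_all add: inv_into_into f_inv_into_f[where f = "\<lambda>u x. u x - L \<epsilon> u x"])
  have \<rho>0_eq: "\<rho>0 \<epsilon> = (\<lambda>x. (L \<epsilon> (h 0) x - h 0 x) - (\<Sum>n=1..k. \<epsilon> ^ n / fact n * G n x))" for \<epsilon>
    by (simp add: \<rho>0_def sum_atMost_eq_sum_from_1 G_0 fun_eq_iff)
  have jump: "(\<lambda>x. L \<epsilon> (h 0) x - h 0 x) \<in> Cl0 l" if "\<epsilon> \<in> E" for \<epsilon>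
    using that h(1)[OF zero_param(1)] annealed_Cl[OF that] annealed_integral[OF that]
    by (simp add: Cl0_def Cl_diff Cl_integral_diff[of _ l])
  have \<rho>0_Cl0: "\<rho>0 \<epsilon> \<in> Cl0 l" if "\<epsilon> \<in> E" for \<epsilon>
    unfolding \<rho>0_eq by (intro Cl0_diff jump that Cl0_sum Cl0_mult_left G_Cl0) auto
  have \<rho>_Cl: "\<rho> i \<epsilon> \<in> Cl l" if "?near \<epsilon>" "i \<in> {1..k}" for i \<epsilon>
    unfolding \<rho>_def using that
    by (intro Cl_diff Cl0D(1)[OF inv(1)] taylor_poly_Cl b_Cl G_Cl0) auto
  have expansion: "(\<lambda>x. h \<epsilon> x - (\<Sum>n\<le>k. \<epsilon> ^ n / fact n * ?d n x))
      = (\<lambda>x. ?inv \<epsilon> (\<rho>0 \<epsilon>) x + (\<Sum>i=1..k. \<epsilon> ^ i / fact i * \<rho> i \<epsilon> x))" if n: "?near \<epsilon>" for \<epsilon>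
  proof -
    have \<epsilon>: "\<epsilon> \<in> E" using n by simp
    \<comment> \<open>The candidate \<open>?w\<close> for \<open>h \<epsilon> - h 0\<close> has average zero and the right image under \<open>I - L \<epsilon>\<close>.\<close>
    let ?w = "\<lambda>x. ?inv \<epsilon> (\<rho>0 \<epsilon>) x + (\<Sum>i=1..k. \<epsilon> ^ i / fact i * ?inv \<epsilon> (G i) x)"
    have G_inv: "?inv \<epsilon> (G i) \<in> Cl0 l" "\<And>x. ?inv \<epsilon> (G i) x - L \<epsilon> (?inv \<epsilon> (G i)) x = G i x"
      if "i \<in> {1..k}" for i
      using inv[OF n G_Cl0[of i]] that by (auto dest: fun_cong)
    have sum_Cl0: "(\<lambda>x. \<Sum>i=1..k. \<epsilon> ^ i / fact i * ?inv \<epsilon> (G i) x) \<in> Cl0 l"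
      by (intro Cl0_sum Cl0_mult_left G_inv)
    have w: "?w \<in> Cl0 l"
      by (rule Cl0_add[OF inv(1)[OF n \<rho>0_Cl0[OF \<epsilon>]] sum_Cl0])
    have diff: "(\<lambda>x. h \<epsilon> x - h 0 x) \<in> Cl0 l"
      using h[OF \<epsilon>] h[OF zero_param(1)]
      by (simp add: Cl0_def Cl_diff Cl_integral_diff[of _ l])
    have "L \<epsilon> ?w = (\<lambda>x. L \<epsilon> (?inv \<epsilon> (\<rho>0 \<epsilon>)) x
        + L \<epsilon> (\<lambda>x. \<Sum>i=1..k. \<epsilon> ^ i / fact i * ?inv \<epsilon> (G i) x) x)"
      by (rule annealed_add[OF \<epsilon> Cl0D(1)[OF inv(1)[OF n \<rho>0_Cl0[OF \<epsilon>]]] Cl0D(1)[OF sum_Cl0]])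
    also have "L \<epsilon> (\<lambda>x. \<Sum>i=1..k. \<epsilon> ^ i / fact i * ?inv \<epsilon> (G i) x)
        = (\<lambda>x. \<Sum>i=1..k. L \<epsilon> (\<lambda>x. \<epsilon> ^ i / fact i * ?inv \<epsilon> (G i) x) x)"
      by (rule annealed_sum[OF \<epsilon> Cl_mult_left[OF Cl0D(1)[OF G_inv(1)]]])
    finally have "L \<epsilon> ?w = (\<lambda>x. L \<epsilon> (?inv \<epsilon> (\<rho>0 \<epsilon>)) x
        + (\<Sum>i=1..k. \<epsilon> ^ i / fact i * L \<epsilon> (?inv \<epsilon> (G i)) x))"
      unfolding annealed_mult_left .
    then have "(\<lambda>x. ?w x - L \<epsilon> ?w x)
        = (\<lambda>x. (?inv \<epsilon> (\<rho>0 \<epsilon>) x - L \<epsilon> (?inv \<epsilon> (\<rho>0 \<epsilon>)) x)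
            + (\<Sum>i=1..k. \<epsilon> ^ i / fact i * (?inv \<epsilon> (G i) x - L \<epsilon> (?inv \<epsilon> (G i)) x)))"
      by (simp add: right_diff_distrib sum_subtractf fun_eq_iff del: times_divide_eq_left)
    also have "\<dots> = (\<lambda>x. \<rho>0 \<epsilon> x + (\<Sum>i=1..k. \<epsilon> ^ i / fact i * G i x))"
      using inv(2)[OF n \<rho>0_Cl0[OF \<epsilon>]] by (simp add: G_inv(2) fun_eq_iff)
    also have "\<dots> = (\<lambda>x. (h \<epsilon> x - h 0 x) - L \<epsilon> (\<lambda>x. h \<epsilon> x - h 0 x) x)"
      unfolding annealed_diff[OF \<epsilon> h(1)[OF \<epsilon>] h(1)[OF zero_param(1)]] h(2)[OF \<epsilon>] \<rho>0_eq by simp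
    finally have "?w = (\<lambda>x. h \<epsilon> x - h 0 x)"
      using inj_onD[OF bij_betw_imp_inj_on[OF bij] _ w diff, of \<epsilon>] n by blast
    then have h_eq: "h \<epsilon> x = h 0 x + ?w x" for x by (simp add: fun_eq_iff algebra_simps)
    have "(\<Sum>n\<le>k. \<epsilon> ^ n / fact n * ?d n x)
        = h 0 x + (\<Sum>i=1..k. \<epsilon> ^ i / fact i * (\<Sum>j\<le>k - i. \<epsilon> ^ j / fact j * b i j x))" for x
    proof -
      have "(\<Sum>n\<le>k. \<epsilon> ^ n / fact n * ?d n x)
          = h 0 x + (\<Sum>n=1..k. \<epsilon> ^ n / fact n * (\<Sum>i=1..n. real (n choose i) * b i (n - i) x))"
        unfolding sum_atMost_eq_sum_from_1 by (auto intro!: sum.cong)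
      then show ?thesis unfolding sum_triangle_binomial .
    qed
    then show ?thesis
      unfolding h_eq \<rho>_def by (simp add: right_diff_distrib sum_subtractf fun_eq_iff)
  qed
  have "(\<lambda>\<epsilon>. Cl_norm l (\<lambda>x. h \<epsilon> x - (\<Sum>n\<le>k. \<epsilon> ^ n / fact n * ?d n x))) \<in> o[at 0 within E](\<lambda>\<epsilon>. \<epsilon> ^ k)"
  proof (rule smallo_dominated)
    have "(\<lambda>\<epsilon>. Cl_norm l (\<rho>0 \<epsilon>)) \<in> o[at 0 within E](\<lambda>\<epsilon>. \<epsilon> ^ k)"
      using G by (simp add: taylor_at_0_def \<rho>0_def[abs_def])
    then have "(\<lambda>\<epsilon>. K * Cl_norm l (\<rho>0 \<epsilon>)) \<in> o[at 0 within E](\<lambda>\<epsilon>. 1 * \<epsilon> ^ k)"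
      by (intro landau_o.big_small_mult) auto
    moreover have "(\<lambda>\<epsilon>. \<bar>\<epsilon> ^ i / fact i\<bar> * Cl_norm l (\<rho> i \<epsilon>)) \<in> o[at 0 within E](\<lambda>\<epsilon>. 1 * \<epsilon> ^ k)"
      if i: "i \<in> {1..k}" for i
    proof -
      have "(\<lambda>\<epsilon>. Cl_norm l (\<rho> i \<epsilon>)) \<in> o[at 0 within E](\<lambda>\<epsilon>. \<epsilon> ^ (k - i))"
        using b[of i] i by (simp add: taylor_at_0_def \<rho>_def[abs_def])
      moreover have "(\<lambda>\<epsilon>. \<bar>\<epsilon> ^ i / fact i\<bar>) \<in> O[at 0 within E](\<lambda>\<epsilon>. \<epsilon> ^ i)"
        by (rule bigoI[of _ "1 / fact i"]) (simp add: abs_mult)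
      ultimately have "(\<lambda>\<epsilon>. \<bar>\<epsilon> ^ i / fact i\<bar> * Cl_norm l (\<rho> i \<epsilon>)) \<in> o[at 0 within E](\<lambda>\<epsilon>. \<epsilon> ^ i * \<epsilon> ^ (k - i))"
        by (intro landau_o.big_small_mult)
      then show ?thesis using i by (simp flip: power_add)
    qed
    ultimately show "(\<lambda>\<epsilon>. K * Cl_norm l (\<rho>0 \<epsilon>) + (\<Sum>i=1..k. \<bar>\<epsilon> ^ i / fact i\<bar> * Cl_norm l (\<rho> i \<epsilon>)))
        \<in> o[at 0 within E](\<lambda>\<epsilon>. \<epsilon> ^ k)"
      by (intro sum_in_smallo big_sum_in_smallo) auto
    show "\<forall>\<^sub>F \<epsilon> in at 0 within E.
        \<bar>Cl_norm l (\<lambda>x. h \<epsilon> x - (\<Sum>n\<le>k. \<epsilon> ^ n / fact n * ?d n x))\<bar>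
        \<le> \<bar>K * Cl_norm l (\<rho>0 \<epsilon>) + (\<Sum>i=1..k. \<bar>\<epsilon> ^ i / fact i\<bar> * Cl_norm l (\<rho> i \<epsilon>))\<bar>"
      using near
    proof eventually_elim
      case n: (elim \<epsilon>)
      have inv_Cl: "?inv \<epsilon> (\<rho>0 \<epsilon>) \<in> Cl l"
        using n by (intro Cl0D(1)[OF inv(1)] \<rho>0_Cl0) auto
      have t: "(\<lambda>x. \<epsilon> ^ i / fact i * \<rho> i \<epsilon> x) \<in> Cl l" if "i \<in> {1..k}" for i
        by (intro Cl_mult_left \<rho>_Cl[OF n that])
      let ?R = "\<lambda>x. ?inv \<epsilon> (\<rho>0 \<epsilon>) x + (\<Sum>i=1..k. \<epsilon> ^ i / fact i * \<rho> i \<epsilon> x)"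
      have "Cl_norm l ?R \<le> Cl_norm l (?inv \<epsilon> (\<rho>0 \<epsilon>)) + (\<Sum>i=1..k. Cl_norm l (\<lambda>x. \<epsilon> ^ i / fact i * \<rho> i \<epsilon> x))"
        by (rule order_trans[OF Cl_norm_add[OF inv_Cl Cl_sum[OF t]] add_left_mono[OF Cl_norm_sum[OF t]]])
      also have "\<dots> \<le> K * Cl_norm l (\<rho>0 \<epsilon>) + (\<Sum>i=1..k. \<bar>\<epsilon> ^ i / fact i\<bar> * Cl_norm l (\<rho> i \<epsilon>))"
        using n by (intro add_mono sum_mono Cl_norm_mult_left \<rho>_Cl bounded \<rho>0_Cl0) auto
      finally have "Cl_norm l ?R \<le> K * Cl_norm l (\<rho>0 \<epsilon>) + (\<Sum>i=1..k. \<bar>\<epsilon> ^ i / fact i\<bar> * Cl_norm l (\<rho> i \<epsilon>))" .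
      moreover have "0 \<le> Cl_norm l ?R"
        by (rule Cl_norm_nonneg[OF Cl_add[OF inv_Cl Cl_sum[OF t]]])
      ultimately show ?case unfolding expansion[OF n] by linarith
    qed
  qed
  moreover have "?d n \<in> Cl l" if "n \<le> k" for n
    using that h(1)[OF zero_param(1)] by (auto intro!: Cl_sum Cl_mult_left b_Cl)
  moreover have "\<forall>\<^sub>F \<epsilon> in at 0 within E. h \<epsilon> \<in> Cl l"
    using near by eventually_elim (use h(1) in auto)
  ultimately show ?thesis by (simp add: taylor_at_0_def)
qed

end

theorem theorem3p2:
  fixes l k :: nat
    and E :: "real set"
    and W :: "'w measure"
    and P :: "real \<Rightarrow> 'w measure"
    and A :: "'a set"
    and I :: "'a \<Rightarrow> 'w \<Rightarrow> real set"
    and T :: "'w \<Rightarrow> real \<Rightarrow> real"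
    and h :: "real \<Rightarrow> real \<Rightarrow> real"
    and G :: "nat \<Rightarrow> real \<Rightarrow> real"
    and H :: "nat \<Rightarrow> nat \<Rightarrow> real \<Rightarrow> real"
  assumes maps: "random_maps l E W P A I T"
    and l: "l \<ge> 1"
    and h: "\<And>\<epsilon>. \<epsilon> \<in> E \<Longrightarrow> h \<epsilon> \<in> Cl l \<and> invariant_density T (P \<epsilon>) (h \<epsilon>)"
    and G: "\<And>i. G i = nth_deriv_at_0 l E i (\<lambda>\<epsilon>. annealed_op A I T (P \<epsilon>) (h 0))"
    and H: "\<And>i j. H i j =
          nth_deriv_at_0 l E j (\<lambda>\<epsilon>. inv_I_minus l (annealed_op A I T (P \<epsilon>)) (G i))"
    and gap: "uniform_spectral_gap l E (\<lambda>\<epsilon>. annealed_op A I T (P \<epsilon>))"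
    and bounded: "inv_I_minus_uniformly_bounded l E (\<lambda>\<epsilon>. annealed_op A I T (P \<epsilon>))"
    and diff_L: "times_diff_at_0 l E k (\<lambda>\<epsilon>. annealed_op A I T (P \<epsilon>) (h 0))"
    and diff_inv: "\<And>i. 1 \<le> i \<Longrightarrow> i \<le> k \<Longrightarrow>
          times_diff_at_0 l E (k - i) (\<lambda>\<epsilon>. inv_I_minus l (annealed_op A I T (P \<epsilon>)) (G i))"
  shows "times_diff_at_0 l E k h \<and>
    (\<lambda>\<epsilon>. Cl_norm l (\<lambda>x. h \<epsilon> x - (h 0 x + (\<Sum>n=1..k. \<epsilon> ^ n / fact n * nth_deriv_at_0 l E n h x))))
      \<in> o[at 0 within E](\<lambda>\<epsilon>. \<epsilon> ^ k) \<and>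
    (\<forall>n\<in>{1..k}. nth_deriv_at_0 l E n h = (\<lambda>x. \<Sum>i=1..n. real (n choose i) * H i (n - i) x))"
proof -
  interpret random_maps l E W P A I T by (rule maps)
  have h_Cl: "h \<epsilon> \<in> Cl l" and h_fixed: "L \<epsilon> (h \<epsilon>) = h \<epsilon>" and h_mean: "(\<integral>x. h \<epsilon> x \<partial>leb01) = 1"
    if "\<epsilon> \<in> E" for \<epsilon>
    using h[OF that] invariant_density_fixed[OF that] invariant_density_integral by auto
  obtain \<delta> r1 where \<delta>: "\<delta> < 1" and r1: "0 < r1"
    and gap': "\<And>\<epsilon>. \<epsilon> \<in> E \<Longrightarrow> \<bar>\<epsilon>\<bar> < r1 \<Longrightarrow>
        Cl_simple_eigenvalue l (L \<epsilon>) 1 \<and> Cl_spectrum l (L \<epsilon>) - {1} \<subseteq> ball 0 \<delta>"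
    using gap unfolding uniform_spectral_gap_def by blast
  obtain K r2 where r2: "0 < r2"
    and K: "\<And>\<epsilon> g. \<epsilon> \<in> E \<Longrightarrow> \<bar>\<epsilon>\<bar> < r2 \<Longrightarrow> g \<in> Cl0 l \<Longrightarrow>
        Cl_norm l (inv_I_minus l (L \<epsilon>) g) \<le> K * Cl_norm l g"
    using bounded unfolding inv_I_minus_uniformly_bounded_def by blast
  have bij: "bij_betw (\<lambda>u x. u x - L \<epsilon> u x) (Cl0 l) (Cl0 l)" if \<epsilon>: "\<epsilon> \<in> E" "\<bar>\<epsilon>\<bar> < min r1 r2" for \<epsilon>
    using gap'[OF \<epsilon>(1)] K[OF \<epsilon>(1)] \<epsilon>(2)
    by (intro I_minus_bij[OF \<epsilon>(1) h_Cl[OF \<epsilon>(1)] h_fixed[OF \<epsilon>(1)] h_mean[OF \<epsilon>(1)] _ _ \<delta>]) auto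
  obtain c where c: "taylor_at_0 l E k (\<lambda>\<epsilon>. L \<epsilon> (h 0)) c"
    using diff_L unfolding times_diff_at_0_def by blast
  have G_eq: "G i = c i" if "i \<le> k" for i
    unfolding G by (rule nth_deriv_at_0_eq[OF zero_param(2) c that])
  have G_taylor: "taylor_at_0 l E k (\<lambda>\<epsilon>. L \<epsilon> (h 0)) G"
    using c G_eq by (simp add: taylor_at_0_def)
  obtain b where b: "\<And>i. 1 \<le> i \<Longrightarrow> i \<le> k \<Longrightarrow>
      taylor_at_0 l E (k - i) (\<lambda>\<epsilon>. inv_I_minus l (L \<epsilon>) (G i)) (b i)"
    using diff_inv unfolding times_diff_at_0_def by metis
  have H_eq: "H i j = b i j" if "1 \<le> i" "i + j \<le> k" for i j
    unfolding H using that by (intro nth_deriv_at_0_eq[OF zero_param(2) b]) auto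
  let ?d = "\<lambda>n. if n = 0 then h 0 else (\<lambda>x. \<Sum>i=1..n. real (n choose i) * b i (n - i) x)"
  have d: "taylor_at_0 l E k h ?d"
    using r1 r2 K by (intro density_taylor[OF h_Cl h_fixed h_mean bij _ _ G_taylor b, of "min r1 r2"]) auto
  have deriv: "nth_deriv_at_0 l E n h = ?d n" if "n \<le> k" for n
    by (rule nth_deriv_at_0_eq[OF zero_param(2) d that])
  have poly: "h 0 x + (\<Sum>n=1..k. \<epsilon> ^ n / fact n * nth_deriv_at_0 l E n h x)
      = (\<Sum>n\<le>k. \<epsilon> ^ n / fact n * ?d n x)" for \<epsilon> x
    unfolding sum_atMost_eq_sum_from_1 using deriv by (auto intro!: sum.cong)
  have "times_diff_at_0 l E k h"
    using d unfolding times_diff_at_0_def by blast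
  moreover have "(\<lambda>\<epsilon>. Cl_norm l (\<lambda>x. h \<epsilon> x - (h 0 x + (\<Sum>n=1..k. \<epsilon> ^ n / fact n * nth_deriv_at_0 l E n h x))))
      \<in> o[at 0 within E](\<lambda>\<epsilon>. \<epsilon> ^ k)"
    unfolding poly using d unfolding taylor_at_0_def by blast
  moreover have "nth_deriv_at_0 l E n h = (\<lambda>x. \<Sum>i=1..n. real (n choose i) * H i (n - i) x)"
    if "n \<in> {1..k}" for n
    using that deriv[of n] H_eq by (auto intro!: ext sum.cong)
  ultimately show ?thesis by blast
qed

end
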